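(* For an integer $n \geqslant 1$, let $G$ be the group generated by elements $a_i, b_i$, $1 \leqslant i \leqslant n$, and if $n > 1$, then also by elements $c_j$, $1 \leqslant j \leqslant n-1$, with the following defining relations: (1) $a_i^4 = b_i^4 = c_j^2 = 1$ for $1 \leqslant i \leqslant n$, $1 \leqslant j \leqslant n-1$; (2) $[a_i,a_j] = [b_i,b_j] = [a_i,c_k] = [b_i,c_k] = [c_k,c_\ell] = 1$ for $1 \leqslant i,j \leqslant n$, $1 \leqslant k,\ell \leqslant n-1$; (3) $a_i^2 = b_i^2$ and $a_i^{b_i} = a_i^{-1}$ for $1 \leqslant i \leqslant n$; (4) for $1 \leqslant i,j \leqslant n$ with $i \neq j$, $[a_i,b_j] = c_{\min\{i,j\}}$ if $|i-j| = 1$, and $[a_i,b_j] = 1$ if $|i-j| \geqslant 2$. Then $G$ is an indecomposable special $2$-group of order $2^{4n-1}$ such that $$\Omega_1(G) = Z(G) = \mathrm{Fix}(\phi)$$ for some $\phi \in \mathrm{Aut}(G)$ of order $3$.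
   Context: Conventions: $x^y = y^{-1}xy$ and $[x,y] = x^{-1}y^{-1}xy$. $\Omega_1(G)$ is the subgroup generated by all elements of order $2$ in $G$, $Z(G)$ is the center, and $\mathrm{Fix}(\phi)$ is the set of elements of $G$ fixed by $\phi$. A group $G$ is indecomposable if whenever $G = A \times B$ (internal direct product of subgroups), then $A = 1$ or $B = 1$. A $p$-group $P$ is special if it is either elementary abelian, or $P' = \Phi(P) = Z(P)$ is elementary abelian; all special groups considered here are non-abelian, i.e. the second alternative holds. *)

theory Defs
  imports "HOL-Computational_Algebra.Primes"
    "HOL-Algebra.Generated_Groups" "HOL-Algebra.Multiplicative_Group" "HOL-Algebra.Bij"
begin

section \<open>Groups given by generators and relations\<close>

text \<open>The letter \<open>(g, True)\<close> stands for \<open>g\<close> and \<open>(g, False)\<close> for its formal inverse.\<close>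

type_synonym 'g word = "('g \<times> bool) list"

definition words :: "'g set \<Rightarrow> 'g word set" where
  "words X = lists (X \<times> UNIV)"

definition winv :: "'g word \<Rightarrow> 'g word" where
  "winv w = rev (map (\<lambda>(g, s). (g, \<not> s)) w)"

definition wpow :: "'g word \<Rightarrow> nat \<Rightarrow> 'g word" where
  "wpow w k = concat (replicate k w)"

definition wconj :: "'g word \<Rightarrow> 'g word \<Rightarrow> 'g word" where
  "wconj x y = winv y @ x @ y"

definition wcomm :: "'g word \<Rightarrow> 'g word \<Rightarrow> 'g word" where
  "wcomm x y = winv x @ winv y @ x @ y"

text \<open>A pair \<open>(u, v) \<in> R\<close> is the relation \<open>u = v\<close>. The group presented by generators \<open>X\<close> and
  relations \<open>R\<close> is the set of words over \<open>X\<close> modulo the least congruence that allows free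
  cancellation and identifies both sides of every relation.\<close>

inductive word_cong :: "'g set \<Rightarrow> ('g word \<times> 'g word) set \<Rightarrow> 'g word \<Rightarrow> 'g word \<Rightarrow> bool"
  for X R where
  wc_refl: "w \<in> words X \<Longrightarrow> word_cong X R w w"
| wc_sym: "word_cong X R u v \<Longrightarrow> word_cong X R v u"
| wc_trans: "word_cong X R u v \<Longrightarrow> word_cong X R v w \<Longrightarrow> word_cong X R u w"
| wc_append: "word_cong X R u u' \<Longrightarrow> word_cong X R v v' \<Longrightarrow> word_cong X R (u @ v) (u' @ v')"
| wc_cancel: "g \<in> X \<Longrightarrow> word_cong X R [(g, s), (g, \<not> s)] []"
| wc_rel: "(u, v) \<in> R \<Longrightarrow> u \<in> words X \<Longrightarrow> v \<in> words X \<Longrightarrow> word_cong X R u v"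

definition word_class :: "'g set \<Rightarrow> ('g word \<times> 'g word) set \<Rightarrow> 'g word \<Rightarrow> 'g word set" where
  "word_class X R w = {v. word_cong X R w v}"

definition presented_group :: "'g set \<Rightarrow> ('g word \<times> 'g word) set \<Rightarrow> 'g word set monoid" where
  "presented_group X R =
     \<lparr>carrier = word_class X R ` words X,
      mult = (\<lambda>P Q. \<Union>u\<in>P. \<Union>v\<in>Q. word_class X R (u @ v)),
      one = word_class X R []\<rparr>"

lemma word_cong_words: "word_cong X R u v \<Longrightarrow> u \<in> words X \<and> v \<in> words X"
  by (induction rule: word_cong.induct) (auto simp: words_def)

lemma word_class_eq_iff:
  assumes "u \<in> words X"
  shows "word_class X R u = word_class X R v \<longleftrightarrow> word_cong X R u v"
  using assms unfolding word_class_def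
  by (auto intro: wc_refl wc_sym wc_trans dest: word_cong_words)

lemma presented_group_mult:
  assumes "u \<in> words X" "v \<in> words X"
  shows "word_class X R u \<otimes>\<^bsub>presented_group X R\<^esub> word_class X R v = word_class X R (u @ v)"
proof -
  have "word_class X R (u' @ v') = word_class X R (u @ v)"
    if "u' \<in> word_class X R u" "v' \<in> word_class X R v" for u' v'
  proof -
    have "word_cong X R (u' @ v') (u @ v)"
      using that unfolding word_class_def mem_Collect_eq by (rule wc_append[OF wc_sym wc_sym])
    then show ?thesis
      using word_class_eq_iff word_cong_words by blast
  qed
  moreover have "u \<in> word_class X R u" "v \<in> word_class X R v"
    using assms by (auto simp: word_class_def intro: wc_refl)
  ultimately have "(\<Union>u'\<in>word_class X R u. \<Union>v'\<in>word_class X R v. word_class X R (u' @ v')) =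
      word_class X R (u @ v)"
    by blast
  then show ?thesis
    by (simp add: presented_group_def)
qed

lemma winv_words: "w \<in> words X \<Longrightarrow> winv w \<in> words X"
  by (auto simp: words_def winv_def)

lemma winv_cancel: "w \<in> words X \<Longrightarrow> word_cong X R (winv w @ w) []"
proof (induction w)
  case Nil
  then show ?case by (simp add: winv_def wc_refl)
next
  case (Cons a w)
  obtain g s where a: "a = (g, s)" by fastforce
  have g: "g \<in> X" and w: "w \<in> words X" using Cons.prems by (auto simp: a words_def)
  have "word_cong X R (([(g, \<not> s), (g, s)]) @ w) ([] @ w)"
    using wc_cancel[OF g, of R "\<not> s"] wc_refl[OF w] by (intro wc_append) auto
  then have "word_cong X R (winv w @ ([(g, \<not> s), (g, s)] @ w)) (winv w @ ([] @ w))"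
    by (rule wc_append[OF wc_refl[OF winv_words[OF w]]])
  then have "word_cong X R (winv w @ ([(g, \<not> s), (g, s)] @ w)) []"
    using Cons.IH[OF w] wc_trans by fastforce
  then show ?case by (simp add: a winv_def)
qed

lemma presented_group_is_group: "group (presented_group X R)"
proof (rule groupI)
  let ?G = "presented_group X R" and ?c = "word_class X R"
  have carr: "carrier ?G = ?c ` words X" and one: "\<one>\<^bsub>?G\<^esub> = ?c []"
    by (auto simp: presented_group_def)
  have app: "u @ v \<in> words X" if "u \<in> words X" "v \<in> words X" for u v :: "'a word"
    using that by (auto simp: words_def)
  show "\<one>\<^bsub>?G\<^esub> \<in> carrier ?G" by (auto simp: carr one words_def)
  fix x assume "x \<in> carrier ?G"
  then obtain u where u: "u \<in> words X" "x = ?c u" by (auto simp: carr)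
  have nil: "[] \<in> words X" by (simp add: words_def)
  show "\<one>\<^bsub>?G\<^esub> \<otimes>\<^bsub>?G\<^esub> x = x"
    using u nil by (simp add: one presented_group_mult)
  show "\<exists>y\<in>carrier ?G. y \<otimes>\<^bsub>?G\<^esub> x = \<one>\<^bsub>?G\<^esub>"
  proof
    show "?c (winv u) \<in> carrier ?G" using u winv_words by (auto simp: carr)
    have "?c (winv u @ u) = ?c []"
      using word_class_eq_iff app winv_words[OF u(1)] u(1) winv_cancel[OF u(1)] by metis
    then show "?c (winv u) \<otimes>\<^bsub>?G\<^esub> x = \<one>\<^bsub>?G\<^esub>"
      using u winv_words[OF u(1)] by (simp add: one presented_group_mult)
  qed
  fix y assume "y \<in> carrier ?G"
  then obtain v where v: "v \<in> words X" "y = ?c v" by (auto simp: carr)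
  show "x \<otimes>\<^bsub>?G\<^esub> y \<in> carrier ?G"
    using u v app by (auto simp: carr presented_group_mult)
  fix z assume "z \<in> carrier ?G"
  then obtain w where w: "w \<in> words X" "z = ?c w" by (auto simp: carr)
  show "x \<otimes>\<^bsub>?G\<^esub> y \<otimes>\<^bsub>?G\<^esub> z = x \<otimes>\<^bsub>?G\<^esub> (y \<otimes>\<^bsub>?G\<^esub> z)"
    using u v w app by (simp add: presented_group_mult)
qed

text \<open>The universal property (von Dyck), with \<open>weval\<close> evaluating a word in a group.\<close>

primrec weval :: "('a, 'b) monoid_scheme \<Rightarrow> ('g \<Rightarrow> 'a) \<Rightarrow> 'g word \<Rightarrow> 'a" where
  "weval H f [] = \<one>\<^bsub>H\<^esub>"
| "weval H f (x # w) =
     (if snd x then f (fst x) else inv\<^bsub>H\<^esub> f (fst x)) \<otimes>\<^bsub>H\<^esub> weval H f w"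

lemma (in group) weval_closed:
  "f \<in> X \<rightarrow> carrier G \<Longrightarrow> w \<in> words X \<Longrightarrow> weval G f w \<in> carrier G"
proof (induction w)
  case (Cons a w)
  then have "w \<in> words X" "f (fst a) \<in> carrier G" by (auto simp: words_def)
  then show ?case using Cons by simp
qed simp

lemma (in group) weval_append:
  assumes "f \<in> X \<rightarrow> carrier G" "v \<in> words X"
  shows "u \<in> words X \<Longrightarrow> weval G f (u @ v) = weval G f u \<otimes> weval G f v"
proof (induction u)
  case Nil
  then show ?case using weval_closed[OF assms] by simp
next
  case (Cons a u)
  then have u: "u \<in> words X" and "f (fst a) \<in> carrier G"
    using assms(1) by (auto simp: words_def)
  then show ?case
    using Cons.IH[OF u] weval_closed[OF assms] weval_closed[OF assms(1) u]
    by (simp add: m_assoc)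
qed

lemma (in group) weval_cong:
  assumes f: "f \<in> X \<rightarrow> carrier G" and R: "\<And>u v. (u, v) \<in> R \<Longrightarrow> weval G f u = weval G f v"
  shows "word_cong X R u v \<Longrightarrow> weval G f u = weval G f v"
proof (induction rule: word_cong.induct)
  case (wc_append u u' v v')
  have "u \<in> words X" "u' \<in> words X" "v \<in> words X" "v' \<in> words X"
    using wc_append.hyps word_cong_words by blast+
  then show ?case
    using wc_append.IH by (simp add: weval_append[OF f])
next
  case (wc_cancel g s)
  then have "f g \<in> carrier G" using f by auto
  then show ?case by auto
qed (auto simp: R)

lemma (in group) presented_group_universal:
  assumes f: "f \<in> X \<rightarrow> carrier G" and R: "\<And>u v. (u, v) \<in> R \<Longrightarrow> weval G f u = weval G f v"
  shows "\<exists>h \<in> hom (presented_group X R) G. \<forall>w\<in>words X. h (word_class X R w) = weval G f w"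
proof -
  let ?h = "\<lambda>P. weval G f (SOME w. w \<in> P)"
  have h: "?h (word_class X R w) = weval G f w" if "w \<in> words X" for w
  proof -
    have "w \<in> word_class X R w" using that by (simp add: word_class_def wc_refl)
    then have "(SOME v. v \<in> word_class X R w) \<in> word_class X R w" by (rule someI)
    then show ?thesis
      using weval_cong[where X = X and R = R, OF f R] by (simp add: word_class_def)
  qed
  have app: "u @ v \<in> words X" if "u \<in> words X" "v \<in> words X" for u v :: "'c word"
    using that by (auto simp: words_def)
  have "?h \<in> hom (presented_group X R) G"
  proof (rule homI)
    fix P assume "P \<in> carrier (presented_group X R)"
    then obtain u where u: "u \<in> words X" "P = word_class X R u"
      by (auto simp: presented_group_def)
    then show "?h P \<in> carrier G" using h weval_closed[OF f] by simp
    fix Q assume "Q \<in> carrier (presented_group X R)"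
    then obtain v where v: "v \<in> words X" "Q = word_class X R v"
      by (auto simp: presented_group_def)
    show "?h (P \<otimes>\<^bsub>presented_group X R\<^esub> Q) = ?h P \<otimes> ?h Q"
      unfolding u(2) v(2) presented_group_mult[OF u(1) v(1)]
      using h[OF u(1)] h[OF v(1)] h[OF app[OF u(1) v(1)]] weval_append[OF f v(1) u(1)] by simp
  qed
  moreover have "\<forall>w\<in>words X. ?h (word_class X R w) = weval G f w"
    using h by blast
  ultimately show ?thesis by (rule bexI[where x = ?h, rotated])
qed


section \<open>Group-theoretic notions\<close>

definition center :: "('a, 'b) monoid_scheme \<Rightarrow> 'a set" where
  "center G = {z \<in> carrier G. \<forall>x\<in>carrier G. z \<otimes>\<^bsub>G\<^esub> x = x \<otimes>\<^bsub>G\<^esub> z}"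

definition maximal_subgroup :: "'a set \<Rightarrow> ('a, 'b) monoid_scheme \<Rightarrow> bool" where
  "maximal_subgroup M G \<longleftrightarrow> subgroup M G \<and> M \<noteq> carrier G \<and>
     (\<forall>H. subgroup H G \<longrightarrow> M \<subseteq> H \<longrightarrow> H = M \<or> H = carrier G)"

text \<open>This is the whole group if there are no maximal subgroups.\<close>

definition frattini :: "('a, 'b) monoid_scheme \<Rightarrow> 'a set" where
  "frattini G = carrier G \<inter> \<Inter>{M. maximal_subgroup M G}"

definition Omega1 :: "('a, 'b) monoid_scheme \<Rightarrow> 'a set" where
  "Omega1 G = generate G {x \<in> carrier G. group.ord G x = 2}"

definition fixed_points :: "('a, 'b) monoid_scheme \<Rightarrow> ('a \<Rightarrow> 'a) \<Rightarrow> 'a set" where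
  "fixed_points G \<phi> = {x \<in> carrier G. \<phi> x = x}"

definition internal_direct_product ::
    "('a, 'b) monoid_scheme \<Rightarrow> 'a set \<Rightarrow> 'a set \<Rightarrow> bool" where
  "internal_direct_product G A B \<longleftrightarrow>
     A \<lhd> G \<and> B \<lhd> G \<and> A \<inter> B = {\<one>\<^bsub>G\<^esub>} \<and> A <#>\<^bsub>G\<^esub> B = carrier G"

definition indecomposable :: "('a, 'b) monoid_scheme \<Rightarrow> bool" where
  "indecomposable G \<longleftrightarrow>
     (\<forall>A B. internal_direct_product G A B \<longrightarrow> A = {\<one>\<^bsub>G\<^esub>} \<or> B = {\<one>\<^bsub>G\<^esub>})"

definition p_group :: "nat \<Rightarrow> ('a, 'b) monoid_scheme \<Rightarrow> bool" where
  "p_group p G \<longleftrightarrow> prime p \<and> group G \<and>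
     (\<forall>x\<in>carrier G. \<exists>k. group.ord G x = p ^ k)"

definition elementary_abelian :: "nat \<Rightarrow> ('a, 'b) monoid_scheme \<Rightarrow> bool" where
  "elementary_abelian p G \<longleftrightarrow> prime p \<and> comm_group G \<and>
     (\<forall>x\<in>carrier G. x [^]\<^bsub>G\<^esub> p = \<one>\<^bsub>G\<^esub>)"

definition special_p_group :: "nat \<Rightarrow> ('a, 'b) monoid_scheme \<Rightarrow> bool" where
  "special_p_group p G \<longleftrightarrow> p_group p G \<and>
     (elementary_abelian p G \<or>
      derived G (carrier G) = frattini G \<and> frattini G = center G \<and>
      elementary_abelian p (G\<lparr>carrier := center G\<rparr>))"


section \<open>The group \<open>G\<close>\<close>

datatype gen = GenA nat | GenB nat | GenC nat

abbreviation gen_a :: "nat \<Rightarrow> gen word" where "gen_a i \<equiv> [(GenA i, True)]"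
abbreviation gen_b :: "nat \<Rightarrow> gen word" where "gen_b i \<equiv> [(GenB i, True)]"
abbreviation gen_c :: "nat \<Rightarrow> gen word" where "gen_c j \<equiv> [(GenC j, True)]"

definition G_gens :: "nat \<Rightarrow> gen set" where
  "G_gens n = GenA ` {1..n} \<union> GenB ` {1..n} \<union> GenC ` {1..n - 1}"

definition G_rels :: "nat \<Rightarrow> (gen word \<times> gen word) set" where
  "G_rels n =
     {(wpow (gen_a i) 4, []) |i. i \<in> {1..n}} \<union>
     {(wpow (gen_b i) 4, []) |i. i \<in> {1..n}} \<union>
     {(wpow (gen_c j) 2, []) |j. j \<in> {1..n - 1}} \<union>
     {(wcomm (gen_a i) (gen_a j), []) |i j. i \<in> {1..n} \<and> j \<in> {1..n}} \<union>
     {(wcomm (gen_b i) (gen_b j), []) |i j. i \<in> {1..n} \<and> j \<in> {1..n}} \<union>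
     {(wcomm (gen_a i) (gen_c k), []) |i k. i \<in> {1..n} \<and> k \<in> {1..n - 1}} \<union>
     {(wcomm (gen_b i) (gen_c k), []) |i k. i \<in> {1..n} \<and> k \<in> {1..n - 1}} \<union>
     {(wcomm (gen_c k) (gen_c l), []) |k l. k \<in> {1..n - 1} \<and> l \<in> {1..n - 1}} \<union>
     {(wpow (gen_a i) 2, wpow (gen_b i) 2) |i. i \<in> {1..n}} \<union>
     {(wconj (gen_a i) (gen_b i), winv (gen_a i)) |i. i \<in> {1..n}} \<union>
     {(wcomm (gen_a i) (gen_b j), gen_c (min i j)) |i j.
        i \<in> {1..n} \<and> j \<in> {1..n} \<and> i \<noteq> j \<and> \<bar>int i - int j\<bar> = 1} \<union>
     {(wcomm (gen_a i) (gen_b j), []) |i j.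
        i \<in> {1..n} \<and> j \<in> {1..n} \<and> i \<noteq> j \<and> \<bar>int i - int j\<bar> \<ge> 2}"

definition G_group :: "nat \<Rightarrow> gen word set monoid" where
  "G_group n = presented_group (G_gens n) (G_rels n)"

text \<open>No relation is dropped by the side conditions of \<open>wc_rel\<close>.\<close>

lemma G_rels_words: "G_rels n \<subseteq> words (G_gens n) \<times> words (G_gens n)"
proof -
  have gens: "GenA i \<in> G_gens n \<longleftrightarrow> 1 \<le> i \<and> i \<le> n" "GenB i \<in> G_gens n \<longleftrightarrow> 1 \<le> i \<and> i \<le> n"
    "GenC i \<in> G_gens n \<longleftrightarrow> 1 \<le> i \<and> i \<le> n - 1" for i
    by (auto simp: G_gens_def)
  have min: "min i j \<le> n - Suc 0" if "i \<le> n" "j \<le> n" "i \<noteq> j" for i j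
    using that by linarith
  show ?thesis
    unfolding G_rels_def words_def wpow_def wcomm_def wconj_def winv_def numeral_eq_Suc
    by (intro Un_least subsetI; clarsimp simp: gens min)
qed

end

theory Submission
  imports Defs "HOL-Algebra.Elementary_Groups" "HOL-Algebra.Zassenhaus"
begin

text \<open>
  Modulo the squares \<open>z_i = a_i\<^sup>2 = b_i\<^sup>2\<close> and the \<open>c_j\<close>, all of which are central of order at most \<open>2\<close>,
  the group becomes \<open>V = (F_2\<^sup>2)\<^sup>n\<close>, the \<open>i\<close>-th plane being spanned by \<open>a_i\<close> and \<open>b_i\<close>. Moving
  \<open>b\<close>'s to the right past \<open>a\<close>'s shows that multiplication is given by a cocycle on \<open>V\<close> that is
  \<^emph>\<open>bilinear\<close> over \<open>F_2\<close>, with one \<open>z_i\<close>-component for each plane and one \<open>c_j\<close>-component for each pair of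
  neighbouring planes. A bilinear cocycle always defines a group, here the group \<open>model n\<close> on
  \<open>V \<times> F_2\<^sup>n \<times> F_2\<^bsup>n-1\<^esup>\<close>. It satisfies the relations and has order
  \<open>2\<^bsup>4n-1\<^esup>\<close>; conversely, the relations bound the order of the presented group by the same number
  (\<open>relations_order_bound\<close>), so the two are isomorphic (\<open>G_group_coordinates\<close>).

  Everything else is linear algebra over \<open>F_2\<close>. Write \<open>u_i\<close> for the component of \<open>u \<in> V\<close> in the \<open>i\<close>-th
  plane and \<open>\<langle>,\<rangle>\<close> for the symplectic form of a plane. The commutator of elements over \<open>u\<close> and \<open>v\<close>
  has \<open>z_i\<close>-component \<open>\<langle>u_i, v_i\<rangle>\<close> and \<open>c_i\<close>-component \<open>\<langle>u_i, v_{i+1}\<rangle> + \<langle>u_{i+1}, v_i\<rangle>\<close>; the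
  former are nondegenerate together, so the center is the part over \<open>0 \<in> V\<close>. The square of an element
  over \<open>u\<close> has as its \<open>z_i\<close>-component the anisotropic form \<open>x\<^sup>2 + xy + y\<^sup>2\<close> at \<open>u_i\<close>, so all involutions are
  central. The commutators \<open>[a_i, b_i]\<close> and \<open>[a_j, b_{j+1}]\<close> generate the center, so it is the derived
  subgroup; it lies in every maximal subgroup, and every noncentral element is missed by the kernel
  of some coordinate of \<open>V\<close>, so it is the Frattini subgroup as well.

  The form \<open>x\<^sup>2 + xy + y\<^sup>2\<close> is the norm from \<open>F_4\<close> to \<open>F_2\<close>. Multiplication by a primitive cube root of
  unity in every plane preserves it and all symplectic forms; it lifts to the automorphism
  \<open>a_i \<mapsto> b_i\<close>, \<open>b_i \<mapsto> a_i b_i\<close> (\<open>order_3_automorphism\<close>), which fixes the center and nothing else,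
  since it has no nonzero fixed vector on \<open>V\<close>.

  Finally, let \<open>G = A \<times> B\<close>. The factors commute and their images span \<open>V\<close>. Two commuting
  elements have linearly dependent components in every plane, so in each plane only one of
  the factors is visible. The \<open>c_j\<close>-components force neighbouring planes to be occupied by the same
  factor. So one factor is central (\<open>commuting_cover_factor_central\<close>); then the other one
  contains all commutators, hence the center, hence the first factor, which is therefore trivial.
\<close>

section \<open>Evaluating words in a presented group\<close>

lemma presented_group_gen_closed:
  "g \<in> X \<Longrightarrow> word_class X R [(g, s)] \<in> carrier (presented_group X R)"
  by (auto simp: presented_group_def words_def)

lemma presented_group_one: "\<one>\<^bsub>presented_group X R\<^esub> = word_class X R []"
  by (simp add: presented_group_def)

lemma presented_group_inv_gen:
  assumes "g \<in> X"
  shows "inv\<^bsub>presented_group X R\<^esub> word_class X R [(g, True)] = word_class X R [(g, False)]"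
proof -
  interpret group "presented_group X R" by (rule presented_group_is_group)
  have w: "[(g, s)] \<in> words X" "[(g, s), (g, t)] \<in> words X" for s t
    using assms by (auto simp: words_def)
  have "word_class X R [(g, False), (g, True)] = word_class X R []"
    using wc_cancel[OF assms, of R False] word_class_eq_iff[OF w(2)] by simp
  then show ?thesis
    using assms by (intro inv_equality)
      (simp_all add: presented_group_gen_closed presented_group_mult w presented_group_one)
qed

text \<open>Every word is the value of itself at the canonical generators. Thus the relations become equations
  between group elements, and the rest of the work takes place in a group rather than with words.\<close>

lemma weval_presented_group:
  "w \<in> words X \<Longrightarrow>
    weval (presented_group X R) (\<lambda>g. word_class X R [(g, True)]) w = word_class X R w"
proof (induction w)
  case Nil
  then show ?case by (simp add: presented_group_one)
next
  case (Cons p w)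
  obtain g s where p: "p = (g, s)" by fastforce
  have g: "g \<in> X" and w: "w \<in> words X" and gs: "[(g, s)] \<in> words X"
    using Cons.prems by (auto simp: p words_def)
  have "(if s then word_class X R [(g, True)]
      else inv\<^bsub>presented_group X R\<^esub> word_class X R [(g, True)]) = word_class X R [(g, s)]"
    using presented_group_inv_gen[OF g] by (cases s) simp_all
  then show ?case
    using Cons.IH[OF w] presented_group_mult[OF gs w, of R] by (cases s) (simp_all add: p)
qed

lemma presented_group_relation:
  assumes "(u, v) \<in> R" "u \<in> words X" "v \<in> words X"
  shows "weval (presented_group X R) (\<lambda>g. word_class X R [(g, True)]) u =
    weval (presented_group X R) (\<lambda>g. word_class X R [(g, True)]) v"
  using assms by (simp add: weval_presented_group word_class_eq_iff wc_rel)

lemma (in group) weval_in_generate: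
  "w \<in> words X \<Longrightarrow> weval G f w \<in> generate G (f ` X)"
  by (induction w) (auto simp: words_def intro!: generate.eng intro: generate.intros)

lemma presented_group_generated:
  "carrier (presented_group X R) =
    generate (presented_group X R) ((\<lambda>g. word_class X R [(g, True)]) ` X)" (is "_ = ?H")
proof -
  interpret group "presented_group X R" by (rule presented_group_is_group)
  have "word_class X R w \<in> ?H" if "w \<in> words X" for w
    using weval_in_generate[OF that] weval_presented_group[OF that] by metis
  moreover have "?H \<subseteq> carrier (presented_group X R)"
    by (intro generate_incl) (auto simp: presented_group_gen_closed)
  ultimately show ?thesis
    by (auto simp: presented_group_def)
qed

lemma (in group) comm_word_iff:
  assumes "x \<in> carrier G" "y \<in> carrier G" "z \<in> carrier G"
  shows "inv x \<otimes> (inv y \<otimes> (x \<otimes> y)) = z \<longleftrightarrow> x \<otimes> y = y \<otimes> x \<otimes> z"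
  using assms by (simp add: inv_solve_left' m_assoc)

text \<open>Read as equations between group elements, the relations serve twice: they are verified
  in the concrete model, and they are facts about the presented group.\<close>

lemma (in group) relations_iff:
  assumes f: "f \<in> G_gens n \<rightarrow> carrier G"
  defines "a \<equiv> \<lambda>i. f (GenA i)" and "b \<equiv> \<lambda>i. f (GenB i)" and "c \<equiv> \<lambda>i. f (GenC i)"
  shows "(\<forall>(u, v) \<in> G_rels n. weval G f u = weval G f v) \<longleftrightarrow>
    (\<forall>i\<in>{1..n}. a i \<otimes> a i \<otimes> (a i \<otimes> a i) = \<one> \<and> b i \<otimes> b i \<otimes> (b i \<otimes> b i) = \<one>) \<and>
    (\<forall>j\<in>{1..n-1}. c j \<otimes> c j = \<one>) \<and>
    (\<forall>i\<in>{1..n}. \<forall>j\<in>{1..n}. a i \<otimes> a j = a j \<otimes> a i \<and> b i \<otimes> b j = b j \<otimes> b i) \<and>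
    (\<forall>i\<in>{1..n}. \<forall>k\<in>{1..n-1}. a i \<otimes> c k = c k \<otimes> a i \<and> b i \<otimes> c k = c k \<otimes> b i) \<and>
    (\<forall>k\<in>{1..n-1}. \<forall>l\<in>{1..n-1}. c k \<otimes> c l = c l \<otimes> c k) \<and>
    (\<forall>i\<in>{1..n}. a i \<otimes> a i = b i \<otimes> b i \<and> a i \<otimes> b i = b i \<otimes> inv a i) \<and>
    (\<forall>i\<in>{1..n}. \<forall>j\<in>{1..n}. \<bar>int i - int j\<bar> = 1 \<longrightarrow> a i \<otimes> b j = b j \<otimes> a i \<otimes> c (min i j)) \<and>
    (\<forall>i\<in>{1..n}. \<forall>j\<in>{1..n}. \<bar>int i - int j\<bar> \<ge> 2 \<longrightarrow> a i \<otimes> b j = b j \<otimes> a i)"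
proof -
  have a: "f (GenA i) \<in> carrier G" if "i \<in> {1..n}" for i using f that by (auto simp: G_gens_def)
  have b: "f (GenB i) \<in> carrier G" if "i \<in> {1..n}" for i using f that by (auto simp: G_gens_def)
  have c: "f (GenC i) \<in> carrier G" if "i \<in> {1..n-1}" for i using f that by (auto simp: G_gens_def)
  have pow2: "weval G f (wpow [(g, True)] 2) = f g \<otimes> f g" if "f g \<in> carrier G" for g
    using that by (simp add: wpow_def numeral_eq_Suc)
  have pow4: "weval G f (wpow [(g, True)] 4) = f g \<otimes> f g \<otimes> (f g \<otimes> f g)" if "f g \<in> carrier G" for g
    using that by (simp add: wpow_def numeral_eq_Suc m_assoc)
  have comm: "weval G f (wcomm [(g, True)] [(k, True)]) = z \<longleftrightarrow> f g \<otimes> f k = f k \<otimes> f g \<otimes> z"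
    if "f g \<in> carrier G" "f k \<in> carrier G" "z \<in> carrier G" for g k z
    using that by (simp add: wcomm_def winv_def comm_word_iff)
  have conj: "weval G f (wconj [(g, True)] [(k, True)]) = weval G f (winv [(g, True)]) \<longleftrightarrow>
      f g \<otimes> f k = f k \<otimes> inv f g"
    if "f g \<in> carrier G" "f k \<in> carrier G" for g k
    using that by (simp add: wconj_def winv_def inv_solve_left')
  have cmin: "min i j \<in> {1..n-1}" if "i \<in> {1..n}" "j \<in> {1..n}" "\<bar>int i - int j\<bar> = 1" for i j
    using that by auto
  have collect1: "(\<forall>p\<in>{F i |i. P i}. Q p) \<longleftrightarrow> (\<forall>i. P i \<longrightarrow> Q (F i))"
    for F :: "nat \<Rightarrow> gen word \<times> gen word" and P Q by blast
  have collect2: "(\<forall>p\<in>{F i j |i j. P i j}. Q p) \<longleftrightarrow> (\<forall>i j. P i j \<longrightarrow> Q (F i j))"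
    for F :: "nat \<Rightarrow> nat \<Rightarrow> gen word \<times> gen word" and P Q by blast
  have adj: "weval G f (wcomm (gen_a i) (gen_b j)) = weval G f (gen_c (min i j)) \<longleftrightarrow>
      a i \<otimes> b j = b j \<otimes> a i \<otimes> c (min i j)"
    if "i \<in> {1..n}" "j \<in> {1..n}" "\<bar>int i - int j\<bar> = 1" for i j
    using comm[OF a[OF that(1)] b[OF that(2)] c[OF cmin[OF that]]] c[OF cmin[OF that]]
    by (simp add: a_def b_def c_def)
  show ?thesis
    unfolding G_rels_def ball_Un collect1 collect2 prod.case weval.simps(1)
    using adj
    by (simp add: a b c pow2 pow4 comm conj a_def b_def c_def cong: conj_cong imp_cong) fastforce
qed

section \<open>An order bound from squares and commutators\<close>

text \<open>If \<open>x\<close> normalizes \<open>N = \<langle>T\<rangle>\<close> and \<open>x\<^sup>2 \<in> N\<close>, then \<open>N\<close> and \<open>xN\<close> together are closed under multiplication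
  and inversion. Normalization is required only on the generators in \<open>T\<close>, as a statement
  about commutators.\<close>

lemma (in group) generate_insert_square:
  assumes T: "T \<subseteq> carrier G" and x: "x \<in> carrier G" "x \<otimes> x \<in> generate G T"
    and comm: "\<And>t. t \<in> T \<Longrightarrow> \<exists>k\<in>generate G T. t \<otimes> x = x \<otimes> t \<otimes> k"
  shows "generate G (insert x T) \<subseteq> generate G T \<union> (\<lambda>k. x \<otimes> k) ` generate G T"
proof -
  let ?N = "generate G T"
  interpret N: subgroup ?N G by (rule generate_is_subgroup[OF T])
  have NG: "k \<in> carrier G" if "k \<in> ?N" for k using that by (rule N.mem_carrier)
  have cancel: "x \<otimes> (inv x \<otimes> k) = k" if "k \<in> carrier G" for k
    using that x by (simp flip: m_assoc)
  have conj: "inv x \<otimes> k \<otimes> x \<in> ?N" if "k \<in> ?N" for k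
    using that
  proof induction
    case one
    then show ?case using x by simp
  next
    case (incl t)
    obtain k where k: "k \<in> ?N" "t \<otimes> x = x \<otimes> t \<otimes> k" using comm[OF incl] by blast
    have "inv x \<otimes> t \<otimes> x = t \<otimes> k"
      using incl T x k(1) k(2) by (simp add: m_assoc inv_solve_left' NG subset_iff)
    then show ?case using k incl by (simp add: generate.incl)
  next
    case (inv t)
    obtain k where k: "k \<in> ?N" "t \<otimes> x = x \<otimes> t \<otimes> k" using comm[OF inv] by blast
    have t: "t \<in> carrier G" using inv T by auto
    have "inv x \<otimes> t \<otimes> x = t \<otimes> k"
      using t x k(1) k(2) by (simp add: m_assoc inv_solve_left' NG)
    moreover have "inv x \<otimes> inv t \<otimes> x = inv (inv x \<otimes> t \<otimes> x)"
      using t x by (simp add: inv_mult_group m_assoc)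
    ultimately show ?case using k inv by (simp add: generate.incl)
  next
    case (eng h k)
    have "inv x \<otimes> (h \<otimes> k) \<otimes> x = (inv x \<otimes> h \<otimes> x) \<otimes> (inv x \<otimes> k \<otimes> x)"
      using eng.hyps x by (simp add: m_assoc NG cancel)
    then show ?case using eng.IH by simp
  qed
  have move: "k \<otimes> x = x \<otimes> (inv x \<otimes> k \<otimes> x)" if "k \<in> carrier G" for k
    using that x by (simp add: m_assoc flip: inv_solve_left)
  let ?S = "?N \<union> (\<lambda>k. x \<otimes> k) ` ?N"
  have "subgroup ?S G"
  proof (rule subgroupI)
    show "?S \<subseteq> carrier G" using x NG by auto
    show "?S \<noteq> {}" using N.one_closed by blast
  next
    fix s assume "s \<in> ?S"
    then consider "s \<in> ?N" | k where "k \<in> ?N" "s = x \<otimes> k" by auto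
    then show "inv s \<in> ?S"
    proof cases
      case 2
      have "inv s = x \<otimes> ((inv x \<otimes> inv k \<otimes> x) \<otimes> inv (x \<otimes> x))"
        using 2 x NG[OF 2(1)] by (simp add: inv_mult_group m_assoc cancel)
      moreover have "(inv x \<otimes> inv k \<otimes> x) \<otimes> inv (x \<otimes> x) \<in> ?N"
        using conj 2(1) x(2) by simp
      ultimately show ?thesis by blast
    qed auto
  next
    fix s t assume "s \<in> ?S" and t: "t \<in> ?S"
    then consider "s \<in> ?N" | k where "k \<in> ?N" "s = x \<otimes> k" by auto
    then show "s \<otimes> t \<in> ?S"
    proof cases
      case s: 1
      show ?thesis
      proof (cases "t \<in> ?N")
        case False
        then obtain l where l: "l \<in> ?N" "t = x \<otimes> l" using t by auto
        have "s \<otimes> t = x \<otimes> ((inv x \<otimes> s \<otimes> x) \<otimes> l)"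
          using move[OF NG[OF s]] l x s NG by (simp flip: m_assoc)
        moreover have "(inv x \<otimes> s \<otimes> x) \<otimes> l \<in> ?N" using conj[OF s] l by simp
        ultimately show ?thesis by blast
      qed (use s in auto)
    next
      case s: 2
      show ?thesis
      proof (cases "t \<in> ?N")
        case True
        then have "s \<otimes> t = x \<otimes> (k \<otimes> t)" using s x NG by (simp add: m_assoc)
        then show ?thesis using True s by auto
      next
        case False
        then obtain l where l: "l \<in> ?N" "t = x \<otimes> l" using t by auto
        have "s \<otimes> t = (x \<otimes> x) \<otimes> (inv x \<otimes> k \<otimes> x) \<otimes> l"
          using x NG[OF s(1)] NG[OF l(1)] s(2) l(2) by (simp add: m_assoc cancel)
        moreover have "(x \<otimes> x) \<otimes> (inv x \<otimes> k \<otimes> x) \<otimes> l \<in> ?N"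
          using conj[OF s(1)] l x(2) by simp
        ultimately show ?thesis by simp
      qed
    qed
  qed
  moreover have "insert x T \<subseteq> ?S"
    using x generate.incl[of _ T G] N.one_closed by (force intro: image_eqI[of x _ \<one>])
  ultimately show ?thesis by (intro generate_subgroup_incl)
qed

text \<open>Each element of \<open>F\<close> at most doubles the order, because it squares into \<open>\<langle>T\<rangle>\<close> and commutes with
  everything adjoined before it modulo \<open>\<langle>T\<rangle>\<close>.\<close>

lemma (in group) card_generate_squares_commutators:
  assumes "finite F" "finite (generate G T)" "F \<union> T \<subseteq> carrier G"
    and sq: "\<And>x. x \<in> F \<Longrightarrow> x \<otimes> x \<in> generate G T"
    and comm: "\<And>x y. x \<in> F \<Longrightarrow> y \<in> F \<union> T \<Longrightarrow> \<exists>k\<in>generate G T. y \<otimes> x = x \<otimes> y \<otimes> k"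
  shows "finite (generate G (F \<union> T)) \<and>
    card (generate G (F \<union> T)) \<le> 2 ^ card F * card (generate G T)"
  using assms
proof (induction F)
  case empty
  then show ?case by simp
next
  case (insert x F)
  let ?N = "generate G (F \<union> T)"
  have IH: "finite ?N" "card ?N \<le> 2 ^ card F * card (generate G T)"
    using insert.IH insert.prems by auto
  have mono: "generate G T \<subseteq> ?N" by (rule mono_generate) auto
  have "generate G (insert x (F \<union> T)) \<subseteq> ?N \<union> (\<lambda>k. x \<otimes> k) ` ?N"
    using insert.prems mono by (intro generate_insert_square) blast+
  then have "finite (generate G (insert x (F \<union> T)))"
    and "card (generate G (insert x (F \<union> T))) \<le> card (?N \<union> (\<lambda>k. x \<otimes> k) ` ?N)"
    using IH(1) by (auto intro: card_mono dest: finite_subset)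
  moreover have "card (?N \<union> (\<lambda>k. x \<otimes> k) ` ?N) \<le> 2 * card ?N"
    using card_Un_le[of ?N "(\<lambda>k. x \<otimes> k) ` ?N"] card_image_le[OF IH(1), of "\<lambda>k. x \<otimes> k"] by simp
  ultimately show ?case
    using IH(2) insert.hyps by simp
qed

lemma (in group) commutes_square:
  assumes "x \<in> carrier G" "y \<in> carrier G" "x \<otimes> y = y \<otimes> x"
  shows "x \<otimes> (y \<otimes> y) = (y \<otimes> y) \<otimes> x"
proof -
  have "x \<otimes> (y \<otimes> y) = (x \<otimes> y) \<otimes> y" using assms(1,2) by (simp add: m_assoc)
  also have "\<dots> = y \<otimes> (x \<otimes> y)" using assms(1,2) by (simp add: assms(3) m_assoc)
  also have "\<dots> = (y \<otimes> y) \<otimes> x" using assms(1,2) by (simp add: assms(3) m_assoc)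
  finally show ?thesis .
qed

text \<open>The squares \<open>z_i\<close> and the \<open>c_j\<close> generate a central subgroup of exponent \<open>2\<close>, hence of order at most
  \<open>2\<^bsup>2n-1\<^esup>\<close>. Modulo this subgroup the \<open>2n\<close> elements \<open>a_i\<close>, \<open>b_i\<close> commute and are of order at most \<open>2\<close>.\<close>

lemma (in group) relations_order_bound:
  fixes a b c :: "nat \<Rightarrow> 'a" and n :: nat
  defines "I \<equiv> {1..n}" and "J \<equiv> {1..n-1}"
  assumes carr: "\<And>i. i \<in> I \<Longrightarrow> a i \<in> carrier G" "\<And>i. i \<in> I \<Longrightarrow> b i \<in> carrier G"
      "\<And>j. j \<in> J \<Longrightarrow> c j \<in> carrier G"
    and pow4: "\<And>i. i \<in> I \<Longrightarrow> a i \<otimes> a i \<otimes> (a i \<otimes> a i) = \<one>"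
    and pow2: "\<And>j. j \<in> J \<Longrightarrow> c j \<otimes> c j = \<one>"
    and aa: "\<And>i j. i \<in> I \<Longrightarrow> j \<in> I \<Longrightarrow> a i \<otimes> a j = a j \<otimes> a i"
    and bb: "\<And>i j. i \<in> I \<Longrightarrow> j \<in> I \<Longrightarrow> b i \<otimes> b j = b j \<otimes> b i"
    and ac: "\<And>i j. i \<in> I \<Longrightarrow> j \<in> J \<Longrightarrow> a i \<otimes> c j = c j \<otimes> a i"
    and bc: "\<And>i j. i \<in> I \<Longrightarrow> j \<in> J \<Longrightarrow> b i \<otimes> c j = c j \<otimes> b i"
    and cc: "\<And>i j. i \<in> J \<Longrightarrow> j \<in> J \<Longrightarrow> c i \<otimes> c j = c j \<otimes> c i"
    and sq: "\<And>i. i \<in> I \<Longrightarrow> a i \<otimes> a i = b i \<otimes> b i"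
    and ab: "\<And>i. i \<in> I \<Longrightarrow> a i \<otimes> b i = b i \<otimes> inv a i"
    and adj: "\<And>i j. i \<in> I \<Longrightarrow> j \<in> I \<Longrightarrow> \<bar>int i - int j\<bar> = 1 \<Longrightarrow> a i \<otimes> b j = b j \<otimes> a i \<otimes> c (min i j)"
    and far: "\<And>i j. i \<in> I \<Longrightarrow> j \<in> I \<Longrightarrow> \<bar>int i - int j\<bar> \<ge> 2 \<Longrightarrow> a i \<otimes> b j = b j \<otimes> a i"
    and gen: "carrier G = generate G (a ` I \<union> b ` I \<union> c ` J)"
  shows "finite (carrier G) \<and> card (carrier G) \<le> 2 ^ (4 * n - 1)"
proof -
  define z where "z = (\<lambda>i. a i \<otimes> a i)"
  let ?F = "a ` I \<union> b ` I" and ?T = "z ` I \<union> c ` J"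
  have z_eq: "z i = a i \<otimes> a i" for i by (simp add: z_def)
  have z: "z i \<in> carrier G" if "i \<in> I" for i using that carr by (simp add: z_def)
  have az: "a i \<otimes> z j = z j \<otimes> a i" if "i \<in> I" "j \<in> I" for i j
    using that carr aa by (simp only: z_def commutes_square)
  \<comment> \<open>\<open>z j\<close> commutes with the \<open>a i\<close> as a square of \<open>a j\<close>, and with the \<open>b i\<close> as a square of \<open>b j\<close>.\<close>
  have bz: "b i \<otimes> z j = z j \<otimes> b i" if "i \<in> I" "j \<in> I" for i j
    using that carr bb by (simp only: z_def sq commutes_square)
  have cz: "c i \<otimes> z j = z j \<otimes> c i" if "i \<in> J" "j \<in> I" for i j
    using that carr ac[symmetric] by (simp only: z_def commutes_square)
  have zz: "z i \<otimes> z j = z j \<otimes> z i" if "i \<in> I" "j \<in> I" for i j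
    unfolding z_eq[of j] by (rule commutes_square) (use that carr z az in auto)
  have TG: "?T \<subseteq> carrier G" and FG: "?F \<subseteq> carrier G" using carr z by auto
  have Tcomm: "x \<otimes> t = t \<otimes> x" if "x \<in> ?F \<union> ?T" "t \<in> ?T" for x t
    using that az bz cz cz[symmetric] zz ac bc cc by auto
  have T1: "finite (generate G (?T \<union> {})) \<and> card (generate G (?T \<union> {})) \<le> 2 ^ card ?T * card (generate G {})"
  proof (rule card_generate_squares_commutators)
    fix x assume x: "x \<in> ?T"
    show "x \<otimes> x \<in> generate G {}"
      using x pow4 pow2 by (auto simp: z_def generate_empty)
    fix y assume y: "y \<in> ?T \<union> {}"
    then have "y \<otimes> x = x \<otimes> y" using Tcomm[of y x] x by blast
    then show "\<exists>k\<in>generate G {}. y \<otimes> x = x \<otimes> y \<otimes> k"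
      using subsetD[OF TG, of x] subsetD[OF TG, of y] x y
      by (intro bexI[of _ \<one>]) (simp_all add: generate.one)
  qed (use TG in \<open>auto simp: I_def J_def generate_empty\<close>)
  let ?N = "generate G ?T"
  interpret N: subgroup ?N G by (rule generate_is_subgroup[OF TG])
  have flip: "\<exists>k\<in>?N. x \<otimes> y = y \<otimes> x \<otimes> k"
    if "x \<in> carrier G" "y \<in> carrier G" "\<exists>k\<in>?N. y \<otimes> x = x \<otimes> y \<otimes> k" for x y
  proof -
    obtain k where k: "k \<in> ?N" "y \<otimes> x = x \<otimes> y \<otimes> k" using \<open>\<exists>k\<in>?N. _\<close> by blast
    then have "x \<otimes> y = y \<otimes> x \<otimes> inv k"
      using that N.mem_carrier[OF k(1)] by (simp add: inv_solve_right)
    then show ?thesis using k by blast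
  qed
  have comm_k: "\<exists>k\<in>?N. y \<otimes> x = x \<otimes> y \<otimes> k"
    if "x \<in> carrier G" "y \<in> carrier G" "y \<otimes> x = x \<otimes> y" for x y
    using that N.one_closed by (intro bexI[of _ \<one>]) simp_all
  have ab_k: "\<exists>k\<in>?N. a i \<otimes> b j = b j \<otimes> a i \<otimes> k" if i: "i \<in> I" and j: "j \<in> I" for i j
  proof -
    consider "i = j" | "\<bar>int i - int j\<bar> = 1" | "\<bar>int i - int j\<bar> \<ge> 2" by linarith
    then show ?thesis
    proof cases
      case 1
      have "inv z i \<in> ?N" using i by (intro N.m_inv_closed generate.incl) auto
      moreover have "a i \<otimes> b i = b i \<otimes> a i \<otimes> inv z i"
        using ab[OF i] carr i by (simp add: z_def m_assoc inv_mult_group flip: m_assoc[of "a i" "inv a i"])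
      ultimately show ?thesis using 1 by blast
    next
      case 2
      then have "min i j \<in> J" using i j by (auto simp: I_def J_def)
      then have "c (min i j) \<in> ?N" by (intro generate.incl) auto
      then show ?thesis using adj[OF i j 2] by blast
    next
      case 3
      then show ?thesis using far[OF i j] carr i j by (intro comm_k) auto
    qed
  qed
  have T2: "finite (generate G (?F \<union> ?T)) \<and> card (generate G (?F \<union> ?T)) \<le> 2 ^ card ?F * card ?N"
  proof (rule card_generate_squares_commutators)
    fix x assume x: "x \<in> ?F"
    have xG: "x \<in> carrier G" using x FG by blast
    show "x \<otimes> x \<in> ?N"
      using x by (auto simp: z_def simp flip: sq intro!: generate.incl)
    fix y assume y: "y \<in> ?F \<union> ?T"
    have yG: "y \<in> carrier G" using y FG TG by blast
    show "\<exists>k\<in>?N. y \<otimes> x = x \<otimes> y \<otimes> k"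
    proof (cases "y \<in> ?T")
      case True
      then show ?thesis using Tcomm[of x y] x by (intro comm_k xG yG) auto
    next
      case False
      then consider i j where "i \<in> I" "j \<in> I" "x = a i" "y = a j"
        | i j where "i \<in> I" "j \<in> I" "x = a i" "y = b j"
        | i j where "i \<in> I" "j \<in> I" "x = b i" "y = a j"
        | i j where "i \<in> I" "j \<in> I" "x = b i" "y = b j"
        using x y by blast
      then show ?thesis
      proof cases
        case (1 i j)
        show ?thesis by (intro comm_k xG yG) (simp only: 1 aa)
      next
        case (2 i j)
        show ?thesis unfolding 2(3,4) by (rule flip[OF carr(2,1) ab_k]) (fact 2)+
      next
        case (3 i j)
        show ?thesis unfolding 3(3,4) by (rule ab_k) (fact 3)+
      next
        case (4 i j)
        show ?thesis by (intro comm_k xG yG) (simp only: 4 bb)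
      qed
    qed
  qed (use T1 TG FG in \<open>auto simp: I_def\<close>)
  have "card ?T \<le> n + (n - 1)"
    using card_Un_le[of "z ` I" "c ` J"] card_image_le[of I z] card_image_le[of J c]
    by (simp add: I_def J_def)
  moreover have "card ?F \<le> n + n"
    using card_Un_le[of "a ` I" "b ` I"] card_image_le[of I a] card_image_le[of I b]
    by (simp add: I_def)
  ultimately have "card ?F + card ?T \<le> 4 * n - 1" by (cases n) auto
  then have le: "(2::nat) ^ (card ?F + card ?T) \<le> 2 ^ (4 * n - 1)" by (intro power_increasing) auto
  have "card (generate G (?F \<union> ?T)) \<le> 2 ^ card ?F * 2 ^ card ?T"
  proof -
    have "card ?N \<le> 2 ^ card ?T" using T1 by (simp add: generate_empty)
    then show ?thesis using T2 mult_le_mono2[of "card ?N" "2 ^ card ?T" "2 ^ card ?F"] by linarith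
  qed
  then have "card (generate G (?F \<union> ?T)) \<le> 2 ^ (4 * n - 1)"
    using le by (simp add: power_add)
  moreover have "generate G (?F \<union> ?T) = carrier G"
  proof
    show "generate G (?F \<union> ?T) \<subseteq> carrier G" using FG TG by (intro generate_incl) blast
    show "carrier G \<subseteq> generate G (?F \<union> ?T)" unfolding gen by (intro mono_generate) blast
  qed
  ultimately show ?thesis using T2 by simp
qed

section \<open>Center, derived subgroup and Frattini subgroup\<close>

lemma (in group) center_subgroup: "subgroup (center G) G"
proof (rule subgroupI)
  fix z assume z: "z \<in> center G"
  have zG: "z \<in> carrier G" using z by (simp add: center_def)
  have "inv z \<otimes> x = x \<otimes> inv z" if x: "x \<in> carrier G" for x
  proof -
    have "z \<otimes> x = x \<otimes> z" using z x by (simp only: center_def mem_Collect_eq)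
    then have "inv z \<otimes> (x \<otimes> z) = x" using zG x by (simp add: inv_solve_left')
    then show ?thesis using zG x by (simp add: inv_solve_right m_assoc)
  qed
  then show "inv z \<in> center G" using zG by (simp add: center_def)
next
  fix y z assume "y \<in> center G" "z \<in> center G"
  then have G: "y \<in> carrier G" "z \<in> carrier G"
    and comm: "\<And>x. x \<in> carrier G \<Longrightarrow> y \<otimes> x = x \<otimes> y" "\<And>x. x \<in> carrier G \<Longrightarrow> z \<otimes> x = x \<otimes> z"
    by (simp_all only: center_def mem_Collect_eq)
  have "y \<otimes> z \<otimes> x = x \<otimes> (y \<otimes> z)" if x: "x \<in> carrier G" for x
  proof -
    have "y \<otimes> z \<otimes> x = y \<otimes> (x \<otimes> z)" using G x comm(2)[OF x] by (simp add: m_assoc)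
    also have "\<dots> = x \<otimes> y \<otimes> z" using G x comm(1)[OF x] by (simp flip: m_assoc)
    finally show ?thesis using G x by (simp add: m_assoc)
  qed
  then show "y \<otimes> z \<in> center G" using G by (simp add: center_def)
qed (auto simp: center_def)

lemma (in group) commutator_eq_iff:
  assumes "g \<in> carrier G" "h \<in> carrier G" "k \<in> carrier G"
  shows "g \<otimes> h \<otimes> inv g \<otimes> inv h = k \<longleftrightarrow> g \<otimes> h = k \<otimes> (h \<otimes> g)"
proof -
  have eq: "g \<otimes> h \<otimes> inv g \<otimes> inv h = (g \<otimes> h) \<otimes> inv (h \<otimes> g)"
    using assms by (simp add: inv_mult_group m_assoc)
  show ?thesis unfolding eq using assms by (intro inv_solve_right') simp_all
qed

text \<open>If \<open>G = S Z(G)\<close>, central factors drop out of commutators, so every commutator of \<open>G\<close> is already one of \<open>S\<close>.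
  This gives both the inclusion of the center in the Frattini subgroup and the final step
  of the proof of indecomposability.\<close>

lemma (in group) derived_subset_central_supplement:
  assumes S: "subgroup S G"
    and cover: "\<And>g. g \<in> carrier G \<Longrightarrow> \<exists>s\<in>S. \<exists>z\<in>center G. g = s \<otimes> z"
  shows "derived G (carrier G) \<subseteq> S"
proof -
  have SG: "s \<in> carrier G" if "s \<in> S" for s using S that by (rule subgroup.mem_carrier)
  have "g \<otimes> h \<otimes> inv g \<otimes> inv h \<in> S" if g: "g \<in> carrier G" and h: "h \<in> carrier G" for g h
  proof -
    obtain s y where s: "s \<in> S" "y \<in> center G" "g = s \<otimes> y" using cover[OF g] by blast
    obtain t z where t: "t \<in> S" "z \<in> center G" "h = t \<otimes> z" using cover[OF h] by blast
    have yz: "y \<in> carrier G" "z \<in> carrier G"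
      and comm: "\<And>x. x \<in> carrier G \<Longrightarrow> y \<otimes> x = x \<otimes> y" "\<And>x. x \<in> carrier G \<Longrightarrow> z \<otimes> x = x \<otimes> z"
      using s(2) t(2) by (simp_all only: center_def mem_Collect_eq)
    note carr = SG[OF s(1)] SG[OF t(1)] yz
    define k where "k = s \<otimes> t \<otimes> inv s \<otimes> inv t"
    have k: "k \<in> S"
      unfolding k_def using s(1) t(1) S by (intro subgroup.m_closed subgroup.m_inv_closed)
    have st: "s \<otimes> t = k \<otimes> (t \<otimes> s)"
      using commutator_eq_iff[of s t k] carr SG[OF k] k_def by simp
    have "g \<otimes> h = s \<otimes> (y \<otimes> t) \<otimes> z" using carr by (simp add: s t m_assoc)
    also have "\<dots> = (s \<otimes> t) \<otimes> (y \<otimes> z)" using carr comm(1)[of t] by (simp add: m_assoc)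
    also have "\<dots> = k \<otimes> (t \<otimes> (s \<otimes> z) \<otimes> y)"
      using carr SG[OF k] comm(1)[of z] by (simp add: st m_assoc)
    also have "\<dots> = k \<otimes> (h \<otimes> g)"
      using carr SG[OF k] comm(2)[of s] by (simp add: s t m_assoc flip: m_assoc[of z s y])
    finally have "g \<otimes> h \<otimes> inv g \<otimes> inv h = k"
      using commutator_eq_iff g h SG[OF k] by blast
    then show ?thesis using k by simp
  qed
  then show ?thesis
    unfolding derived_def by (intro generate_subgroup_incl S) blast
qed

text \<open>A maximal subgroup \<open>M\<close> that misses a central \<open>w\<close> satisfies \<open>M Z(G) = G\<close>; then \<open>M\<close> contains all
  commutators, so \<open>w\<close> cannot be a product of commutators. This is valid in every group and
  avoids the theory of maximal subgroups of finite \<open>p\<close>-groups.\<close>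

lemma (in group) derived_Int_center_subset_frattini:
  "derived G (carrier G) \<inter> center G \<subseteq> frattini G"
proof
  fix w assume w: "w \<in> derived G (carrier G) \<inter> center G"
  have "w \<in> M" if M: "maximal_subgroup M G" for M
  proof (rule ccontr)
    assume wM: "w \<notin> M"
    have sub: "subgroup M G" using M by (simp add: maximal_subgroup_def)
    have MG: "m \<in> carrier G" if "m \<in> M" for m using sub that by (rule subgroup.mem_carrier)
    interpret Z: subgroup "center G" G by (rule center_subgroup)
    let ?H = "M <#> center G"
    have normal: "center G \<lhd> G"
    proof (rule normal_invI[OF center_subgroup])
      fix x z assume x: "x \<in> carrier G" and z: "z \<in> center G"
      then have "x \<otimes> z = z \<otimes> x" by (simp only: center_def mem_Collect_eq)
      then show "x \<otimes> z \<otimes> inv x \<in> center G" using x z Z.mem_carrier[OF z] by (simp add: m_assoc)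
    qed
    have subH: "subgroup ?H G"
      using mult_norm_subgroup[OF normal sub] commut_normal[OF sub normal] by simp
    have prodI: "m \<otimes> z \<in> ?H" if "m \<in> M" "z \<in> center G" for m z
      using that unfolding set_mult_def by blast
    have MH: "m \<in> ?H" if "m \<in> M" for m
      using prodI[OF that Z.one_closed] MG[OF that] by simp
    have "w \<in> ?H"
      using prodI[OF subgroup.one_closed[OF sub], of w] w Z.mem_carrier[of w] by simp
    then have "?H = carrier G"
      using M wM subH MH unfolding maximal_subgroup_def by blast
    then have "derived G (carrier G) \<subseteq> M"
      by (intro derived_subset_central_supplement[OF sub]) (unfold set_mult_def, blast)
    then show False using w wM by auto
  qed
  then show "w \<in> frattini G"
    using w by (auto simp: frattini_def center_def)
qed

text \<open>The kernel of a homomorphism onto a group of order \<open>2\<close>, the homomorphism being given as the predicate \<open>P\<close>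
  of having nontrivial image.\<close>

lemma (in group) parity_kernel_maximal:
  assumes mult: "\<And>g h. g \<in> carrier G \<Longrightarrow> h \<in> carrier G \<Longrightarrow> P (g \<otimes> h) \<longleftrightarrow> P g \<noteq> P h"
    and k: "k \<in> carrier G" "P k"
  shows "maximal_subgroup {g \<in> carrier G. \<not> P g} G" (is "maximal_subgroup ?M G")
proof -
  have one: "\<not> P \<one>" using mult[of \<one> \<one>] by simp
  have inv: "P (inv g) = P g" if "g \<in> carrier G" for g
    using mult[of "inv g" g] one that by simp
  have sub: "subgroup ?M G"
    by (rule subgroupI) (use one inv mult in auto)
  have "H = carrier G" if H: "subgroup H G" "?M \<subseteq> H" "H \<noteq> ?M" for H
  proof
    have HG: "g \<in> carrier G" if "g \<in> H" for g using H(1) that by (rule subgroup.mem_carrier)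
    obtain h where h: "h \<in> H" "P h" using H HG by blast
    show "carrier G \<subseteq> H"
    proof
      fix g assume g: "g \<in> carrier G"
      show "g \<in> H"
      proof (cases "P g")
        case True
        then have "inv h \<otimes> g \<in> ?M" using mult inv h g HG by simp
        then have "h \<otimes> (inv h \<otimes> g) \<in> H" using H h by (blast intro: subgroup.m_closed)
        then show ?thesis using g h HG by (simp flip: m_assoc)
      qed (use g H in auto)
    qed
  qed (use H subgroup.subset in blast)
  then show ?thesis
    using sub k unfolding maximal_subgroup_def by blast
qed

section \<open>A concrete model with a bilinear cocycle\<close>

text \<open>The tuple \<open>(X, Y, Z, C)\<close> stands for \<open>\<Prod>_{i\<in>X} a_i \<cdot> \<Prod>_{i\<in>Y} b_i \<cdot> \<Prod>_{i\<in>Z} z_i \<cdot> \<Prod>_{j\<in>C} c_j\<close>, where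
  \<open>z_i = a_i\<^sup>2\<close>. Sets are vectors over \<open>F_2\<close>, and \<open>\<noteq>\<close> between propositions is addition in \<open>F_2\<close>. In a product,
  \<open>z_i\<close> arises from \<open>a_i\<^sup>2\<close>, from \<open>b_i\<^sup>2\<close> and from moving \<open>b_i\<close> past \<open>a_i\<close>; \<open>c_i\<close> arises from moving \<open>b_i\<close> past
  \<open>a_{i+1}\<close> or \<open>b_{i+1}\<close> past \<open>a_i\<close>.\<close>

definition model :: "nat \<Rightarrow> (nat set \<times> nat set \<times> nat set \<times> nat set) monoid" where
  "model n =
    \<lparr>carrier = Pow {1..n} \<times> Pow {1..n} \<times> Pow {1..n} \<times> Pow {1..n-1},
     mult = (\<lambda>(X, Y, Z, C) (X', Y', Z', C').
       (sym_diff X X', sym_diff Y Y',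
        {i. ((i \<in> Z) \<noteq> (i \<in> Z')) \<noteq>
            ((i \<in> X \<and> i \<in> X') \<noteq> ((i \<in> Y \<and> i \<in> Y') \<noteq> (i \<in> Y \<and> i \<in> X')))},
        {i. ((i \<in> C) \<noteq> (i \<in> C')) \<noteq>
            ((i \<in> Y \<and> Suc i \<in> X') \<noteq> (Suc i \<in> Y \<and> i \<in> X'))})),
     one = ({}, {}, {}, {})\<rparr>"

text \<open>The \<open>c\<close>-part of a cocycle value lives on indices \<open>i\<close> such that both \<open>i\<close> and \<open>i + 1\<close> are indices of planes.
  The bounds are in the form that the simplifier gives to \<open>1\<close> in these intervals.\<close>

lemma lower_neighbour_range:
  "i \<in> S \<Longrightarrow> Suc i \<in> T \<Longrightarrow> S \<subseteq> {Suc 0..n} \<Longrightarrow> T \<subseteq> {Suc 0..n} \<Longrightarrow> i \<in> {Suc 0..n - Suc 0}"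
  by fastforce

lemma model_group: "group (model n)"
proof (rule groupI)
  fix u v assume uv: "u \<in> carrier (model n)" "v \<in> carrier (model n)"
  show "u \<otimes>\<^bsub>model n\<^esub> v \<in> carrier (model n)"
    using uv unfolding model_def
    by (cases u, cases v) (auto simp del: atLeastAtMost_iff dest: lower_neighbour_range)
next
  fix u v w
  show "u \<otimes>\<^bsub>model n\<^esub> v \<otimes>\<^bsub>model n\<^esub> w = u \<otimes>\<^bsub>model n\<^esub> (v \<otimes>\<^bsub>model n\<^esub> w)"
    \<comment> \<open>Both sides agree because the cocycle is bilinear; in each coordinate this is a Boolean tautology.\<close>
    by (cases u, cases v, cases w)
      (simp only: model_def monoid.simps prod.case prod.inject set_eq_iff mem_Collect_eq Un_iff
        Diff_iff, intro conjI allI; satx)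
next
  fix u assume u: "u \<in> carrier (model n)"
  obtain X Y Z C where [simp]: "u = (X, Y, Z, C)" by (cases u)
  let ?Z = "{i. (i \<in> Z) \<noteq> (i \<in> X \<or> i \<in> Y)}"
    and ?C = "{i. (i \<in> C) \<noteq> ((i \<in> Y \<and> Suc i \<in> X) \<noteq> (Suc i \<in> Y \<and> i \<in> X))}"
  show "\<exists>v\<in>carrier (model n). v \<otimes>\<^bsub>model n\<^esub> u = \<one>\<^bsub>model n\<^esub>"
  proof
    show "(X, Y, ?Z, ?C) \<otimes>\<^bsub>model n\<^esub> u = \<one>\<^bsub>model n\<^esub>"
      by (auto simp: model_def)
    show "(X, Y, ?Z, ?C) \<in> carrier (model n)"
      using u unfolding model_def by (auto simp del: atLeastAtMost_iff dest: lower_neighbour_range)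
  qed
qed (auto simp: model_def)

lemma card_model: "n \<ge> 1 \<Longrightarrow> card (carrier (model n)) = 2 ^ (4 * n - 1)"
  by (simp add: model_def card_cartesian_product card_Pow flip: power_add)

section \<open>Groups with coordinates in the model\<close>

text \<open>Working with a group that carries coordinates, instead of with \<open>model n\<close> itself, makes every property
  available for the presented group without transporting it along an isomorphism. The model
  is an instance as well, which is used to show that its generators generate it.\<close>

locale coordinates = group G for G (structure) +
  fixes n :: nat and X Y Z C :: "'a \<Rightarrow> nat set"
  assumes coord_iso: "(\<lambda>g. (X g, Y g, Z g, C g)) \<in> iso G (model n)"
begin

lemma coord_eqI:
  assumes "g \<in> carrier G" "h \<in> carrier G" "X g = X h" "Y g = Y h" "Z g = Z h" "C g = C h"
  shows "g = h"
  using coord_iso assms by (auto simp: iso_def bij_betw_def inj_on_def)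

lemma coord_bounds:
  assumes "g \<in> carrier G"
  shows "X g \<subseteq> {1..n}" "Y g \<subseteq> {1..n}" "Z g \<subseteq> {1..n}" "C g \<subseteq> {1..n-1}"
  using coord_iso assms by (auto simp: iso_def hom_def model_def)

lemma coord_exists:
  assumes "x \<subseteq> {1..n}" "y \<subseteq> {1..n}" "z \<subseteq> {1..n}" "c \<subseteq> {1..n-1}"
  obtains g where "g \<in> carrier G" "X g = x" "Y g = y" "Z g = z" "C g = c"
proof -
  have "(x, y, z, c) \<in> carrier (model n)" using assms by (simp add: model_def)
  then have "(x, y, z, c) \<in> (\<lambda>g. (X g, Y g, Z g, C g)) ` carrier G"
    using coord_iso by (simp add: iso_def bij_betw_def)
  then show thesis using that by auto
qed

lemma coord_exists_a:
  assumes "i \<in> {1..n}"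
  obtains a where "a \<in> carrier G" "X a = {i}" "Y a = {}" "Z a = {}" "C a = {}"
  by (rule coord_exists[of "{i}" "{}" "{}" "{}"]) (use assms in auto)

lemma coord_exists_b:
  assumes "i \<in> {1..n}"
  obtains b where "b \<in> carrier G" "X b = {}" "Y b = {i}" "Z b = {}" "C b = {}"
  by (rule coord_exists[of "{}" "{i}" "{}" "{}"]) (use assms in auto)

lemma coord_mult:
  assumes "g \<in> carrier G" "h \<in> carrier G"
  shows "i \<in> X (g \<otimes> h) \<longleftrightarrow> (i \<in> X g) \<noteq> (i \<in> X h)"
    and "i \<in> Y (g \<otimes> h) \<longleftrightarrow> (i \<in> Y g) \<noteq> (i \<in> Y h)"
    and "i \<in> Z (g \<otimes> h) \<longleftrightarrow> ((i \<in> Z g) \<noteq> (i \<in> Z h)) \<noteq>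
      ((i \<in> X g \<and> i \<in> X h) \<noteq> ((i \<in> Y g \<and> i \<in> Y h) \<noteq> (i \<in> Y g \<and> i \<in> X h)))"
    and "i \<in> C (g \<otimes> h) \<longleftrightarrow> ((i \<in> C g) \<noteq> (i \<in> C h)) \<noteq>
      ((i \<in> Y g \<and> Suc i \<in> X h) \<noteq> (Suc i \<in> Y g \<and> i \<in> X h))"
proof -
  have "(X (g \<otimes> h), Y (g \<otimes> h), Z (g \<otimes> h), C (g \<otimes> h)) =
      (X g, Y g, Z g, C g) \<otimes>\<^bsub>model n\<^esub> (X h, Y h, Z h, C h)"
    using coord_iso assms by (simp add: iso_def hom_def)
  then show "i \<in> X (g \<otimes> h) \<longleftrightarrow> (i \<in> X g) \<noteq> (i \<in> X h)"
    and "i \<in> Y (g \<otimes> h) \<longleftrightarrow> (i \<in> Y g) \<noteq> (i \<in> Y h)"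
    and "i \<in> Z (g \<otimes> h) \<longleftrightarrow> ((i \<in> Z g) \<noteq> (i \<in> Z h)) \<noteq>
      ((i \<in> X g \<and> i \<in> X h) \<noteq> ((i \<in> Y g \<and> i \<in> Y h) \<noteq> (i \<in> Y g \<and> i \<in> X h)))"
    and "i \<in> C (g \<otimes> h) \<longleftrightarrow> ((i \<in> C g) \<noteq> (i \<in> C h)) \<noteq>
      ((i \<in> Y g \<and> Suc i \<in> X h) \<noteq> (Suc i \<in> Y g \<and> i \<in> X h))"
    by (simp_all only: model_def monoid.simps prod.case prod.inject Un_iff Diff_iff mem_Collect_eq) blast+
qed

lemma coord_one: "X \<one> = {}" "Y \<one> = {}" "Z \<one> = {}" "C \<one> = {}"
proof -
  show "X \<one> = {}" using coord_mult(1)[of \<one> \<one>] by auto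
  moreover show "Y \<one> = {}" using coord_mult(2)[of \<one> \<one>] by auto
  ultimately show "Z \<one> = {}" "C \<one> = {}"
    using coord_mult(3,4)[of \<one> \<one>] by auto
qed

lemma coord_inv:
  assumes "g \<in> carrier G"
  shows "X (inv g) = X g" "Y (inv g) = Y g"
  using coord_mult(1,2)[of "inv g" g] assms by (auto simp: coord_one)

text \<open>The two conditions say that the commutator has trivial \<open>z_i\<close>- and \<open>c_i\<close>-components for all \<open>i\<close>.\<close>

lemma commute_iff:
  assumes "g \<in> carrier G" "h \<in> carrier G"
  shows "g \<otimes> h = h \<otimes> g \<longleftrightarrow>
    (\<forall>i. (i \<in> X g \<and> i \<in> Y h) = (i \<in> Y g \<and> i \<in> X h)) \<and>
    (\<forall>i. ((i \<in> X g \<and> Suc i \<in> Y h) \<noteq> (Suc i \<in> X g \<and> i \<in> Y h)) =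
         ((i \<in> Y g \<and> Suc i \<in> X h) \<noteq> (Suc i \<in> Y g \<and> i \<in> X h)))" (is "?L \<longleftrightarrow> ?z \<and> ?c")
proof -
  have "?L \<longleftrightarrow> X (g \<otimes> h) = X (h \<otimes> g) \<and> Y (g \<otimes> h) = Y (h \<otimes> g) \<and>
      Z (g \<otimes> h) = Z (h \<otimes> g) \<and> C (g \<otimes> h) = C (h \<otimes> g)"
    using assms coord_eqI[of "g \<otimes> h" "h \<otimes> g"] by auto
  also have "X (g \<otimes> h) = X (h \<otimes> g)" using assms by (auto simp: coord_mult)
  also have "Y (g \<otimes> h) = Y (h \<otimes> g)" using assms by (auto simp: coord_mult)
  also have "Z (g \<otimes> h) = Z (h \<otimes> g) \<longleftrightarrow> ?z"
    using assms by (simp add: set_eq_iff coord_mult, intro iff_allI) satx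
  also have "C (g \<otimes> h) = C (h \<otimes> g) \<longleftrightarrow> ?c"
    using assms by (simp add: set_eq_iff coord_mult, intro iff_allI) satx
  finally show ?thesis by simp
qed

lemma center_eq: "center G = {g \<in> carrier G. X g = {} \<and> Y g = {}}"
proof (intro equalityI subsetI)
  fix g assume "g \<in> center G"
  then have g: "g \<in> carrier G" and comm: "\<And>h. h \<in> carrier G \<Longrightarrow> g \<otimes> h = h \<otimes> g"
    by (auto simp: center_def)
  have "i \<notin> X g \<and> i \<notin> Y g" if i: "i \<in> {1..n}" for i
  proof -
    obtain a where a: "a \<in> carrier G" "X a = {i}" "Y a = {}" "Z a = {}" "C a = {}"
      by (rule coord_exists_a[OF i])
    obtain b where b: "b \<in> carrier G" "X b = {}" "Y b = {i}" "Z b = {}" "C b = {}"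
      by (rule coord_exists_b[OF i])
    show ?thesis
      using comm[OF a(1)] comm[OF b(1)] commute_iff[OF g a(1)] commute_iff[OF g b(1)] a b by auto
  qed
  then show "g \<in> {g \<in> carrier G. X g = {} \<and> Y g = {}}"
    using g coord_bounds[OF g] by auto
next
  fix g assume "g \<in> {g \<in> carrier G. X g = {} \<and> Y g = {}}"
  then show "g \<in> center G"
    by (auto simp: center_def commute_iff)
qed

text \<open>The \<open>z_i\<close>-component of \<open>g\<^sup>2\<close> is \<open>x\<^sup>2 + xy + y\<^sup>2\<close> for the \<open>i\<close>-th coordinates \<open>x\<close>, \<open>y\<close> of \<open>g\<close>. Over \<open>F_2\<close> it
  is nonzero unless \<open>x = y = 0\<close>, so the \<open>z\<close>-coordinates of \<open>g\<^sup>2\<close> form the union of \<open>X g\<close> and \<open>Y g\<close>.\<close>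

lemma square_eq_one_iff:
  assumes "g \<in> carrier G"
  shows "g \<otimes> g = \<one> \<longleftrightarrow> g \<in> center G"
proof -
  have sq: "X (g \<otimes> g) = {}" "Y (g \<otimes> g) = {}" "Z (g \<otimes> g) = X g \<union> Y g"
    using assms by (auto simp: coord_mult)
  moreover have "C (g \<otimes> g) = {}" if "X g = {}"
    using assms that by (auto simp: coord_mult)
  ultimately show ?thesis
    using coord_eqI[of "g \<otimes> g" \<one>] assms by (auto simp: center_eq coord_one)
qed

lemma Omega1_eq_center: "Omega1 G = center G"
proof
  have ord: "ord g = 2 \<longleftrightarrow> g \<noteq> \<one> \<and> g \<otimes> g = \<one>" if "g \<in> carrier G" for g
  proof
    assume "ord g = 2"
    then show "g \<noteq> \<one> \<and> g \<otimes> g = \<one>"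
      using pow_ord_eq_1[OF that] that by (auto simp: numeral_2_eq_2)
  next
    assume "g \<noteq> \<one> \<and> g \<otimes> g = \<one>"
    then have "ord g dvd 2" "ord g \<noteq> 1"
      using that ord_eq_1 by (auto simp: numeral_2_eq_2 simp flip: pow_eq_id)
    then show "ord g = 2" using prime_nat_iff two_is_prime_nat by blast
  qed
  show "Omega1 G \<subseteq> center G"
    unfolding Omega1_def
    by (intro generate_subgroup_incl center_subgroup) (auto simp: ord square_eq_one_iff)
  show "center G \<subseteq> Omega1 G"
  proof
    fix z assume z: "z \<in> center G"
    then have "z \<in> carrier G" by (simp add: center_def)
    then show "z \<in> Omega1 G"
      using z square_eq_one_iff ord unfolding Omega1_def
      by (cases "z = \<one>") (auto intro: generate.one generate.incl)
  qed
qed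

lemma center_elementary_abelian: "elementary_abelian 2 (G\<lparr>carrier := center G\<rparr>)"
proof -
  interpret Z: group "G\<lparr>carrier := center G\<rparr>"
    by (rule subgroup_imp_group[OF center_subgroup])
  have "comm_group (G\<lparr>carrier := center G\<rparr>)"
    by (rule Z.group_comm_groupI) (auto simp: center_eq commute_iff)
  moreover have "z [^]\<^bsub>G\<lparr>carrier := center G\<rparr>\<^esub> (2::nat) = \<one>" if "z \<in> center G" for z
  proof -
    have "z \<in> carrier G" using that by (simp add: center_def)
    then show ?thesis using that by (simp add: numeral_2_eq_2 square_eq_one_iff)
  qed
  ultimately show ?thesis by (auto simp: elementary_abelian_def)
qed

text \<open>This is applied to the derived subgroup and to subgroups that contain all generators.\<close>

lemma center_subset_subgroup:
  assumes S: "subgroup S G"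
    and z: "\<And>i. i \<in> {1..n} \<Longrightarrow> \<exists>g\<in>S. X g = {} \<and> Y g = {} \<and> Z g = {i} \<and> C g = {}"
    and c: "\<And>j. j \<in> {1..n-1} \<Longrightarrow> \<exists>g\<in>S. X g = {} \<and> Y g = {} \<and> Z g = {} \<and> C g = {j}"
  shows "center G \<subseteq> S"
proof -
  have SG: "g \<in> carrier G" if "g \<in> S" for g using S that by (rule subgroup.mem_carrier)
  have Zs: "\<exists>g\<in>S. X g = {} \<and> Y g = {} \<and> Z g = I \<and> C g = {}" if "finite I" "I \<subseteq> {1..n}" for I
    using that
  proof (induction I)
    case empty
    then show ?case using subgroup.one_closed[OF S] coord_one by blast
  next
    case (insert i I)
    then obtain g h where "g \<in> S" "X g = {}" "Y g = {}" "Z g = I" "C g = {}"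
      and "h \<in> S" "X h = {}" "Y h = {}" "Z h = {i}" "C h = {}"
      using z[of i] by auto
    then have "g \<otimes> h \<in> S" "X (g \<otimes> h) = {}" "Y (g \<otimes> h) = {}" "Z (g \<otimes> h) = insert i I" "C (g \<otimes> h) = {}"
      using subgroup.m_closed[OF S, of g h] coord_mult[OF SG SG, of g h] insert.hyps by auto
    then show ?case by blast
  qed
  have ZCs: "\<exists>g\<in>S. X g = {} \<and> Y g = {} \<and> Z g = I \<and> C g = J"
    if "finite J" "I \<subseteq> {1..n}" "J \<subseteq> {1..n-1}" for I J
    using that
  proof (induction J)
    case empty
    then show ?case using Zs[of I] finite_subset by auto
  next
    case (insert j J)
    then obtain g h where "g \<in> S" "X g = {}" "Y g = {}" "Z g = I" "C g = J"
      and "h \<in> S" "X h = {}" "Y h = {}" "Z h = {}" "C h = {j}"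
      using c[of j] by auto
    then have "g \<otimes> h \<in> S" "X (g \<otimes> h) = {}" "Y (g \<otimes> h) = {}" "Z (g \<otimes> h) = I" "C (g \<otimes> h) = insert j J"
      using subgroup.m_closed[OF S, of g h] coord_mult[OF SG SG, of g h] insert.hyps by auto
    then show ?case by blast
  qed
  show ?thesis
  proof
    fix g assume "g \<in> center G"
    then have g: "g \<in> carrier G" "X g = {}" "Y g = {}" by (auto simp: center_eq)
    obtain h where "h \<in> S" "X h = {}" "Y h = {}" "Z h = Z g" "C h = C g"
      using ZCs[of "C g" "Z g"] coord_bounds[OF g(1)] finite_subset by blast
    then show "g \<in> S" using coord_eqI[of h g] g SG by auto
  qed
qed

text \<open>The central elements \<open>z_i\<close> come for free, as the squares of the \<open>a_i\<close>.\<close>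

lemma carrier_subset_subgroup:
  assumes S: "subgroup S G"
    and a: "\<And>i. i \<in> {1..n} \<Longrightarrow> \<exists>g\<in>S. X g = {i} \<and> Y g = {} \<and> Z g = {} \<and> C g = {}"
    and b: "\<And>i. i \<in> {1..n} \<Longrightarrow> \<exists>g\<in>S. X g = {} \<and> Y g = {i} \<and> Z g = {} \<and> C g = {}"
    and c: "\<And>j. j \<in> {1..n-1} \<Longrightarrow> \<exists>g\<in>S. X g = {} \<and> Y g = {} \<and> Z g = {} \<and> C g = {j}"
  shows "carrier G \<subseteq> S"
proof -
  have SG: "g \<in> carrier G" if "g \<in> S" for g using S that by (rule subgroup.mem_carrier)
  have ZS: "center G \<subseteq> S"
  proof (rule center_subset_subgroup[OF S _ c])
    fix i assume "i \<in> {1..n}"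
    then obtain g where "g \<in> S" "X g = {i}" "Y g = {}" "Z g = {}" "C g = {}" using a by blast
    then have "g \<otimes> g \<in> S" "X (g \<otimes> g) = {}" "Y (g \<otimes> g) = {}" "Z (g \<otimes> g) = {i}" "C (g \<otimes> g) = {}"
      using subgroup.m_closed[OF S, of g g] coord_mult[OF SG SG, of g g] by auto
    then show "\<exists>g\<in>S. X g = {} \<and> Y g = {} \<and> Z g = {i} \<and> C g = {}" by blast
  qed
  have Xs: "\<exists>g\<in>S. X g = I \<and> Y g = {}" if "finite I" "I \<subseteq> {1..n}" for I
    using that
  proof (induction I)
    case empty
    then show ?case using subgroup.one_closed[OF S] coord_one by blast
  next
    case (insert i I)
    then obtain g h where "g \<in> S" "X g = I" "Y g = {}" "h \<in> S" "X h = {i}" "Y h = {}"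
      using a[of i] by auto
    then have "g \<otimes> h \<in> S" "X (g \<otimes> h) = insert i I" "Y (g \<otimes> h) = {}"
      using subgroup.m_closed[OF S, of g h] coord_mult[OF SG SG, of g h] insert.hyps by auto
    then show ?case by blast
  qed
  have XYs: "\<exists>g\<in>S. X g = I \<and> Y g = J" if "finite J" "I \<subseteq> {1..n}" "J \<subseteq> {1..n}" for I J
    using that
  proof (induction J)
    case empty
    then show ?case using Xs[of I] finite_subset by auto
  next
    case (insert j J)
    then obtain g h where "g \<in> S" "X g = I" "Y g = J" "h \<in> S" "X h = {}" "Y h = {j}"
      using b[of j] by auto
    then have "g \<otimes> h \<in> S" "X (g \<otimes> h) = I" "Y (g \<otimes> h) = insert j J"
      using subgroup.m_closed[OF S, of g h] coord_mult[OF SG SG, of g h] insert.hyps by auto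
    then show ?case by blast
  qed
  show ?thesis
  proof
    fix g assume g: "g \<in> carrier G"
    then obtain h where h: "h \<in> S" "X h = X g" "Y h = Y g"
      using XYs[of "Y g" "X g"] coord_bounds[OF g] finite_subset by blast
    have "inv h \<otimes> g \<in> center G"
      using g SG[OF h(1)] h by (auto simp: center_eq coord_mult coord_inv)
    then have "h \<otimes> (inv h \<otimes> g) \<in> S"
      using ZS h S by (blast intro: subgroup.m_closed)
    then show "g \<in> S" using g SG[OF h(1)] by (simp flip: m_assoc)
  qed
qed

lemma commutator_in_derived:
  "g \<in> carrier G \<Longrightarrow> h \<in> carrier G \<Longrightarrow> g \<otimes> h \<otimes> inv g \<otimes> inv h \<in> derived G (carrier G)"
  unfolding derived_def by (intro generate.incl) blast

lemma derived_eq_center: "derived G (carrier G) = center G"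
proof
  have "g \<otimes> h \<otimes> inv g \<otimes> inv h \<in> center G" if "g \<in> carrier G" "h \<in> carrier G" for g h
    using that by (auto simp: center_eq coord_mult coord_inv)
  then show "derived G (carrier G) \<subseteq> center G"
    unfolding derived_def by (intro generate_subgroup_incl center_subgroup) blast
  have witness: "\<exists>k\<in>derived G (carrier G). X k = {} \<and> Y k = {} \<and> Z k = z \<and> C k = c"
    if g: "g \<in> carrier G" and h: "h \<in> carrier G"
      and z: "\<And>i. (i \<in> Z (g \<otimes> h)) \<noteq> (i \<in> Z (h \<otimes> g)) \<longleftrightarrow> i \<in> z"
      and c: "\<And>i. (i \<in> C (g \<otimes> h)) \<noteq> (i \<in> C (h \<otimes> g)) \<longleftrightarrow> i \<in> c" for g h z c
  proof -
    define k where "k = g \<otimes> h \<otimes> inv g \<otimes> inv h"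
    have k: "k \<in> carrier G" "k \<otimes> (h \<otimes> g) = g \<otimes> h"
      using g h commutator_eq_iff[of g h k] by (simp_all add: k_def)
    have XY: "X k = {}" "Y k = {}"
      using g h by (auto simp: k_def coord_mult coord_inv)
    \<comment> \<open>\<open>k\<close> lies over zero, so multiplication by \<open>k\<close> adds its central coordinates to those of \<open>h \<otimes> g\<close>.\<close>
    have "Z k = z" "C k = c"
      using z c coord_mult(3,4)[of k "h \<otimes> g"] g h k XY by auto
    moreover have "k \<in> derived G (carrier G)"
      using g h by (simp add: k_def commutator_in_derived)
    ultimately show ?thesis using XY by blast
  qed
  show "center G \<subseteq> derived G (carrier G)"
  proof (rule center_subset_subgroup)
    fix i assume i: "i \<in> {1..n}"
    obtain a where a: "a \<in> carrier G" "X a = {i}" "Y a = {}" "Z a = {}" "C a = {}"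
      by (rule coord_exists_a[OF i])
    obtain b where b: "b \<in> carrier G" "X b = {}" "Y b = {i}" "Z b = {}" "C b = {}"
      by (rule coord_exists_b[OF i])
    show "\<exists>k\<in>derived G (carrier G). X k = {} \<and> Y k = {} \<and> Z k = {i} \<and> C k = {}"
      using a b by (intro witness[of a b]) (auto simp: coord_mult)
  next
    fix j assume j: "j \<in> {1..n-1}"
    obtain a where a: "a \<in> carrier G" "X a = {j}" "Y a = {}" "Z a = {}" "C a = {}"
      by (rule coord_exists_a[of j]) (use j in auto)
    obtain b where b: "b \<in> carrier G" "X b = {}" "Y b = {Suc j}" "Z b = {}" "C b = {}"
      by (rule coord_exists_b[of "Suc j"]) (use j in auto)
    show "\<exists>k\<in>derived G (carrier G). X k = {} \<and> Y k = {} \<and> Z k = {} \<and> C k = {j}"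
      using a b by (intro witness[of a b]) (auto simp: coord_mult)
  qed (simp add: derived_is_subgroup)
qed

lemma frattini_eq_center: "frattini G = center G"
proof
  show "center G \<subseteq> frattini G"
    using derived_Int_center_subset_frattini by (simp add: derived_eq_center)
  show "frattini G \<subseteq> center G"
  proof
    fix g assume g: "g \<in> frattini G"
    have gG: "g \<in> carrier G" using g by (simp add: frattini_def)
    have "i \<notin> X g" for i
    proof
      assume i: "i \<in> X g"
      then have "maximal_subgroup {g \<in> carrier G. i \<notin> X g} G"
        using gG by (intro parity_kernel_maximal) (auto simp: coord_mult)
      then show False using g i by (auto simp: frattini_def)
    qed
    moreover have "i \<notin> Y g" for i
    proof
      assume i: "i \<in> Y g"
      then have "maximal_subgroup {g \<in> carrier G. i \<notin> Y g} G"
        using gG by (intro parity_kernel_maximal) (auto simp: coord_mult)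
      then show False using g i by (auto simp: frattini_def)
    qed
    ultimately show "g \<in> center G" using gG by (auto simp: center_eq)
  qed
qed

lemma order_eq: "n \<ge> 1 \<Longrightarrow> order G = 2 ^ (4 * n - 1)"
  using coord_iso card_model[of n] iso_same_card[OF is_isoI[OF coord_iso]] by (simp add: order_def)

lemma special_2_group:
  assumes "n \<ge> 1" shows "special_p_group 2 G"
proof -
  have "\<exists>k. ord g = 2 ^ k" if "g \<in> carrier G" for g
  proof -
    have "ord g dvd 2 ^ (4 * n - 1)"
      using ord_dvd_group_order[OF that] by (simp only: order_eq[OF assms])
    then show ?thesis by (auto simp: divides_primepow_nat)
  qed
  then show ?thesis
    using is_group derived_eq_center frattini_eq_center center_elementary_abelian
    by (simp add: special_p_group_def p_group_def)
qed

lemma not_abelian: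
  assumes "n \<ge> 1" shows "\<not> comm_group G"
proof
  assume "comm_group G"
  then interpret comm_group G .
  obtain a where a: "a \<in> carrier G" "X a = {1}" "Y a = {}" "Z a = {}" "C a = {}"
    by (rule coord_exists_a[of 1]) (use assms in auto)
  obtain b where b: "b \<in> carrier G" "X b = {}" "Y b = {1}" "Z b = {}" "C b = {}"
    by (rule coord_exists_b[of 1]) (use assms in auto)
  show False using m_comm[OF a(1) b(1)] commute_iff[OF a(1) b(1)] a b by auto
qed

text \<open>A subset is called trivial at \<open>i\<close> if its elements have zero component in the \<open>i\<close>-th plane. In every plane one of
  the factors is trivial: if both had a nonzero vector there, commutation would confine both to
  one common line, so that they could not span the plane. If different factors were trivial at
  \<open>i\<close> and at \<open>i + 1\<close>, then \<open>b_i\<close> and \<open>a_{i+1}\<close> would be covered by different factors; but their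
  commutator is \<open>c_i \<noteq> 1\<close>. So the same factor is trivial everywhere.\<close>

lemma commuting_cover_factor_central:
  assumes G: "A \<subseteq> carrier G" "B \<subseteq> carrier G"
    and comm: "\<And>a b. a \<in> A \<Longrightarrow> b \<in> B \<Longrightarrow> a \<otimes> b = b \<otimes> a"
    and cover: "\<And>g. g \<in> carrier G \<Longrightarrow> \<exists>a\<in>A. \<exists>b\<in>B. g = a \<otimes> b"
  shows "A \<subseteq> center G \<or> B \<subseteq> center G"
proof -
  define trivial where "trivial = (\<lambda>S i. \<forall>g\<in>S. i \<notin> X g \<and> i \<notin> Y g)"
  have form: "(i \<in> X a \<and> i \<in> Y b) = (i \<in> Y a \<and> i \<in> X b)"
    "((i \<in> X a \<and> Suc i \<in> Y b) \<noteq> (Suc i \<in> X a \<and> i \<in> Y b)) =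
     ((i \<in> Y a \<and> Suc i \<in> X b) \<noteq> (Suc i \<in> Y a \<and> i \<in> X b))"
    if "a \<in> A" "b \<in> B" for a b i
    using commute_iff[of a b] comm[OF that] that G by blast+
  have split: "\<exists>a\<in>A. \<exists>b\<in>B. x = ((i \<in> X a) \<noteq> (i \<in> X b)) \<and> y = ((i \<in> Y a) \<noteq> (i \<in> Y b))"
    if i: "i \<in> {1..n}" for i x y
  proof -
    obtain g where g: "g \<in> carrier G" "X g = (if x then {i} else {})" "Y g = (if y then {i} else {})"
      "Z g = {}" "C g = {}"
      by (rule coord_exists[of "if x then {i} else {}" "if y then {i} else {}" "{}" "{}"]) (use i in auto)
    obtain a b where ab: "a \<in> A" "b \<in> B" "g = a \<otimes> b" using cover[OF g(1)] by blast
    have "x = ((i \<in> X a) \<noteq> (i \<in> X b))" "y = ((i \<in> Y a) \<noteq> (i \<in> Y b))"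
      using coord_mult(1,2)[of a b i] ab G g by (auto split: if_splits)
    then show ?thesis using ab by blast
  qed
  have one: "trivial A i \<or> trivial B i" if i: "i \<in> {1..n}" for i
  proof (rule ccontr)
    assume "\<not> ?thesis"
    then obtain a b where a: "a \<in> A" "i \<in> X a \<or> i \<in> Y a" and b: "b \<in> B" "i \<in> X b \<or> i \<in> Y b"
      unfolding trivial_def by blast
    obtain a1 b1 where 1: "a1 \<in> A" "b1 \<in> B" "(i \<in> X a1) \<noteq> (i \<in> X b1)" "(i \<in> Y a1) = (i \<in> Y b1)"
      using split[OF i, of True False] by blast
    obtain a2 b2 where 2: "a2 \<in> A" "b2 \<in> B" "(i \<in> X a2) = (i \<in> X b2)" "(i \<in> Y a2) \<noteq> (i \<in> Y b2)"
      using split[OF i, of False True] by blast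
    \<comment> \<open>All these facts concern the \<open>i\<close>-th plane only: \<open>a\<close> and \<open>b\<close> are nonzero there and commute with each
      other and with the parts of \<open>a_i\<close> and \<open>b_i\<close>, which is impossible.\<close>
    show False
      using a(2) b(2) 1(3,4) 2(3,4) form(1)[OF a(1) b(1), of i] form(1)[OF a(1) 1(2), of i]
        form(1)[OF a(1) 2(2), of i] form(1)[OF 1(1) b(1), of i] form(1)[OF 2(1) b(1), of i]
      by satx
  qed
  have neighbours: "\<not> (trivial A i \<and> trivial B (Suc i)) \<and> \<not> (trivial B i \<and> trivial A (Suc i))"
    if i: "i \<in> {1..n}" "Suc i \<in> {1..n}" for i
  proof -
    obtain a b where ab: "a \<in> A" "b \<in> B" "(i \<in> X a) = (i \<in> X b)" "(i \<in> Y a) \<noteq> (i \<in> Y b)"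
      using split[OF i(1), of False True] by blast
    obtain a' b' where ab': "a' \<in> A" "b' \<in> B" "(Suc i \<in> X a') \<noteq> (Suc i \<in> X b')"
        "(Suc i \<in> Y a') = (Suc i \<in> Y b')"
      using split[OF i(2), of True False] by blast
    show ?thesis
      using ab(3,4) ab'(3,4) form(2)[OF ab'(1) ab(2), of i] form(2)[OF ab(1) ab'(2), of i]
        ab(1,2) ab'(1,2) unfolding trivial_def by blast
  qed
  have spread: "trivial S i"
    if S: "S = A \<or> S = B" and base: "trivial S 1" and i: "i \<ge> 1" "i \<le> n"
    for S i
    using i
  proof (induction i rule: dec_induct)
    case (step j)
    then show ?case using one[of "Suc j"] neighbours[of j] S by auto
  qed (use base in simp)
  have central: "S \<subseteq> center G" if "S \<subseteq> carrier G" "\<And>i. i \<in> {1..n} \<Longrightarrow> trivial S i" for S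
    using that coord_bounds unfolding center_eq trivial_def by blast
  show ?thesis
  proof (cases "n \<ge> 1")
    case True
    then have "trivial A 1 \<or> trivial B 1" using one[of 1] by simp
    then show ?thesis
    proof
      assume "trivial A 1"
      then have "trivial A i" if "i \<in> {1..n}" for i using spread[of A i] that by simp
      then have "A \<subseteq> center G" by (rule central[OF G(1)])
      then show ?thesis ..
    next
      assume "trivial B 1"
      then have "trivial B i" if "i \<in> {1..n}" for i using spread[of B i] that by simp
      then have "B \<subseteq> center G" by (rule central[OF G(2)])
      then show ?thesis ..
    qed
  next
    case False
    then show ?thesis using central[OF G(1)] by auto
  qed
qed

text \<open>Once one factor is central, the other one contains the derived subgroup, which is the whole center; so the
  central factor lies in the intersection of both.\<close>

lemma G_indecomposable: "indecomposable G"
  unfolding indecomposable_def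
proof (intro allI impI)
  fix A B assume "internal_direct_product G A B"
  then have A: "A \<lhd> G" and B: "B \<lhd> G" and int: "A \<inter> B = {\<one>}" and prod: "A <#> B = carrier G"
    by (auto simp: internal_direct_product_def)
  have sub: "subgroup A G" "subgroup B G" using A B by (auto simp: normal_imp_subgroup)
  note AG = subgroup.subset[OF sub(1)] and BG = subgroup.subset[OF sub(2)]
  have comm: "a \<otimes> b = b \<otimes> a" if "a \<in> A" "b \<in> B" for a b
    using normal_imp_commuting[OF A B _ that] int by simp
  have cover: "\<exists>a\<in>A. \<exists>b\<in>B. g = a \<otimes> b" if "g \<in> carrier G" for g
    using that unfolding prod[symmetric] set_mult_def by blast
  have cover': "\<exists>b\<in>B. \<exists>a\<in>A. g = b \<otimes> a" if "g \<in> carrier G" for g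
    using cover[OF that] comm by metis
  from commuting_cover_factor_central[OF AG BG comm cover]
  show "A = {\<one>} \<or> B = {\<one>}"
  proof
    assume "A \<subseteq> center G"
    then have "derived G (carrier G) \<subseteq> B"
      using cover' by (intro derived_subset_central_supplement sub) blast
    then show ?thesis using \<open>A \<subseteq> center G\<close> int unfolding derived_eq_center by blast
  next
    assume "B \<subseteq> center G"
    then have "derived G (carrier G) \<subseteq> A"
      using cover by (intro derived_subset_central_supplement sub) blast
    then show ?thesis using \<open>B \<subseteq> center G\<close> int unfolding derived_eq_center by blast
  qed
qed

text \<open>The map sends \<open>a_i\<close> to \<open>b_i\<close> and \<open>b_i\<close> to \<open>a_i b_i\<close>; on each plane it is multiplication by an element of order
  \<open>3\<close> of \<open>F_4\<close>. Applied to a normal form, it yields a product whose factors have to be sorted again. The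
  \<open>z_i\<close> created by sorting cancel, and the \<open>c_i\<close> are collected in the quadratic term \<open>?q\<close>.\<close>

lemma order_3_automorphism:
  assumes "n \<ge> 1"
  shows "\<exists>\<phi>\<in>auto G. group.ord (AutoGroup G) \<phi> = 3 \<and> center G = fixed_points G \<phi>"
proof -
  let ?q = "\<lambda>g. {i. (i \<in> Y g \<and> Suc i \<in> Y g) \<noteq> ((i \<in> X g \<and> Suc i \<in> Y g) \<noteq> (Suc i \<in> X g \<and> i \<in> Y g))}"
  have "\<exists>h. h \<in> carrier G \<and> X h = Y g \<and> Y h = sym_diff (X g) (Y g) \<and> Z h = Z g \<and>
      C h = sym_diff (C g) (?q g)" if g: "g \<in> carrier G" for g
  proof -
    have q: "?q g \<subseteq> {1..n-1}"
    proof
      fix i assume "i \<in> ?q g"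
      then have "i \<in> X g \<union> Y g" "Suc i \<in> X g \<union> Y g" by blast+
      then show "i \<in> {1..n-1}"
        using lower_neighbour_range[of i "X g \<union> Y g" "X g \<union> Y g" n] coord_bounds(1,2)[OF g] by simp
    qed
    obtain h where "h \<in> carrier G" "X h = Y g" "Y h = sym_diff (X g) (Y g)" "Z h = Z g"
        "C h = sym_diff (C g) (?q g)"
      by (rule coord_exists[of "Y g" "sym_diff (X g) (Y g)" "Z g" "sym_diff (C g) (?q g)"])
        (use coord_bounds[OF g] q in blast)+
    then show ?thesis by (intro exI[of _ h] conjI)
  qed
  then have ex: "\<forall>g\<in>carrier G. \<exists>h. h \<in> carrier G \<and> X h = Y g \<and> Y h = sym_diff (X g) (Y g) \<and> Z h = Z g \<and>
      C h = sym_diff (C g) (?q g)" by (intro ballI)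
  from bchoice[OF ex] obtain f where f: "\<forall>g\<in>carrier G. f g \<in> carrier G \<and> X (f g) = Y g \<and>
      Y (f g) = sym_diff (X g) (Y g) \<and> Z (f g) = Z g \<and> C (f g) = sym_diff (C g) (?q g)" ..
  have f_coord: "f g \<in> carrier G" "i \<in> X (f g) \<longleftrightarrow> i \<in> Y g" "i \<in> Y (f g) \<longleftrightarrow> (i \<in> X g) \<noteq> (i \<in> Y g)"
    "i \<in> Z (f g) \<longleftrightarrow> i \<in> Z g"
    "i \<in> C (f g) \<longleftrightarrow> (i \<in> C g) \<noteq> ((i \<in> Y g \<and> Suc i \<in> Y g) \<noteq>
        ((i \<in> X g \<and> Suc i \<in> Y g) \<noteq> (Suc i \<in> X g \<and> i \<in> Y g)))"
    if "g \<in> carrier G" for g i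
    using bspec[OF f that] by blast+
  have f_mult: "f (g \<otimes> h) = f g \<otimes> f h" if g: "g \<in> carrier G" and h: "h \<in> carrier G" for g h
  proof -
    note simps = coord_mult[OF g h] coord_mult[OF f_coord(1)[OF g] f_coord(1)[OF h]]
      f_coord(2-)[OF m_closed[OF g h]] f_coord(2-)[OF g] f_coord(2-)[OF h]
    have "X (f (g \<otimes> h)) = X (f g \<otimes> f h)" by (intro Set.set_eqI) (simp only: simps)
    moreover have "Y (f (g \<otimes> h)) = Y (f g \<otimes> f h)" by (intro Set.set_eqI, simp only: simps) satx
    moreover have "Z (f (g \<otimes> h)) = Z (f g \<otimes> f h)" by (intro Set.set_eqI, simp only: simps) satx
    moreover have "C (f (g \<otimes> h)) = C (f g \<otimes> f h)" by (intro Set.set_eqI, simp only: simps) satx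
    ultimately show ?thesis using f_coord(1) g h by (intro coord_eqI) simp_all
  qed
  have f3: "f (f (f g)) = g" if g: "g \<in> carrier G" for g
  proof -
    note simps = f_coord(2-)[OF g] f_coord(2-)[OF f_coord(1)[OF g]]
      f_coord(2-)[OF f_coord(1)[OF f_coord(1)[OF g]]]
    have "X (f (f (f g))) = X g" by (intro Set.set_eqI, simp only: simps) satx
    moreover have "Y (f (f (f g))) = Y g" by (intro Set.set_eqI, simp only: simps) satx
    moreover have "Z (f (f (f g))) = Z g" by (intro Set.set_eqI) (simp only: simps)
    moreover have "C (f (f (f g))) = C g" by (intro Set.set_eqI, simp only: simps) satx
    ultimately show ?thesis using f_coord(1) g by (intro coord_eqI) simp_all
  qed
  define \<phi> where "\<phi> = restrict f (carrier G)"
  have "bij_betw f (carrier G) (carrier G)"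
    by (rule bij_betw_byWitness[where f' = "\<lambda>g. f (f g)"]) (use f3 f_coord(1) in auto)
  then have bij: "\<phi> \<in> Bij (carrier G)"
    by (simp add: \<phi>_def Bij_def bij_betw_restrict_eq)
  have aut: "\<phi> \<in> auto G"
    using bij f_mult f_coord(1) by (auto simp: auto_def hom_def \<phi>_def)
  interpret Aut: group "AutoGroup G" by (rule AutoGroup)
  have carr: "\<phi> \<in> carrier (AutoGroup G)" using aut by (simp add: AutoGroup_def)
  have "\<phi> [^]\<^bsub>AutoGroup G\<^esub> (3::nat) = \<phi> \<otimes>\<^bsub>AutoGroup G\<^esub> (\<phi> \<otimes>\<^bsub>AutoGroup G\<^esub> \<phi>)"
    using carr by (simp add: numeral_3_eq_3 Aut.m_assoc)
  also have "\<dots> = compose (carrier G) \<phi> (compose (carrier G) \<phi> \<phi>)"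
    using bij compose_Bij[OF bij bij] by (simp add: AutoGroup_def BijGroup_def)
  also have "\<dots> = \<one>\<^bsub>AutoGroup G\<^esub>"
    using f3 f_coord(1) by (auto simp: AutoGroup_def BijGroup_def compose_def \<phi>_def)
  finally have "Aut.ord \<phi> dvd 3" using Aut.pow_eq_id[OF carr] by simp
  moreover have fixed: "center G = fixed_points G \<phi>"
  proof (intro equalityI subsetI)
    fix g assume "g \<in> center G"
    then have g: "g \<in> carrier G" "X g = {}" "Y g = {}" by (auto simp: center_eq)
    then have "f g = g" using bspec[OF f g(1)] by (intro coord_eqI) simp_all
    then show "g \<in> fixed_points G \<phi>" using g by (simp add: fixed_points_def \<phi>_def)
  next
    fix g assume "g \<in> fixed_points G \<phi>"
    then have g: "g \<in> carrier G" "f g = g" by (auto simp: fixed_points_def \<phi>_def)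
    then have "i \<notin> X g \<and> i \<notin> Y g" for i
      using f_coord(2,3)[OF g(1), of i] by auto
    then show "g \<in> center G" using g by (auto simp: center_eq)
  qed
  moreover have "Aut.ord \<phi> \<noteq> 1"
  proof
    assume "Aut.ord \<phi> = 1"
    then have "\<phi> = \<one>\<^bsub>AutoGroup G\<^esub>" using Aut.ord_eq_1[OF carr] by simp
    then have "fixed_points G \<phi> = carrier G"
      by (auto simp: fixed_points_def AutoGroup_def BijGroup_def)
    then have "carrier G \<subseteq> center G" using fixed by simp
    moreover obtain a where "a \<in> carrier G" "X a = {1}" "Y a = {}" "Z a = {}" "C a = {}"
      by (rule coord_exists_a[of 1]) (use assms in auto)
    ultimately show False by (auto simp: center_eq)
  qed
  moreover have "prime (3::nat)" by simp
  ultimately have "Aut.ord \<phi> = 3" using prime_nat_iff by blast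
  then show ?thesis using aut fixed by blast
qed

end

section \<open>The presented group has coordinates in the model\<close>

definition model_gen :: "gen \<Rightarrow> nat set \<times> nat set \<times> nat set \<times> nat set" where
  "model_gen g = (case g of GenA i \<Rightarrow> ({i}, {}, {}, {}) | GenB i \<Rightarrow> ({}, {i}, {}, {})
     | GenC j \<Rightarrow> ({}, {}, {}, {j}))"

lemma model_gen_closed: "model_gen \<in> G_gens n \<rightarrow> carrier (model n)"
  by (auto simp: G_gens_def model_gen_def model_def)

lemma model_satisfies_relations:
  "\<forall>(u, v) \<in> G_rels n. weval (model n) model_gen u = weval (model n) model_gen v"
proof -
  interpret group "model n" by (rule model_group)
  have inv: "inv\<^bsub>model n\<^esub> ({i}, {}, {}, {}) = ({i}, {}, {i}, {})" if "i \<in> {1..n}" for i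
    by (rule inv_equality) (use that in \<open>auto simp: model_def\<close>)
  have sq: "({i}, {}, {}, {}) \<otimes>\<^bsub>model n\<^esub> ({i}, {}, {}, {}) = ({}, {}, {i}, {})"
    "({}, {i}, {}, {}) \<otimes>\<^bsub>model n\<^esub> ({}, {i}, {}, {}) = ({}, {}, {i}, {})"
    "({}, {}, {i}, {}) \<otimes>\<^bsub>model n\<^esub> ({}, {}, {i}, {}) = \<one>\<^bsub>model n\<^esub>" for i
    by (auto simp: model_def)
  show ?thesis
    unfolding relations_iff[OF model_gen_closed] model_gen_def gen.case
    by (intro conjI ballI impI; (simp only: sq inv)?; (auto simp: model_def)?)
qed

lemma coordinates_model:
  "coordinates (model n) n fst (fst \<circ> snd) (fst \<circ> snd \<circ> snd) (snd \<circ> snd \<circ> snd)"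
  by (intro coordinates.intro model_group coordinates_axioms.intro) (simp add: iso_set_refl)

text \<open>By the universal property there is a homomorphism onto the model, and the order bound leaves no room for a kernel.\<close>

lemma G_group_coordinates:
  assumes "n \<ge> 1"
  shows "\<exists>X Y Z C. coordinates (G_group n) n X Y Z C"
proof -
  let ?M = "model n" and ?G = "G_group n"
  interpret M: group ?M by (rule model_group)
  interpret G: group ?G unfolding G_group_def by (rule presented_group_is_group)
  interpret MC: coordinates ?M n fst "fst \<circ> snd" "fst \<circ> snd \<circ> snd" "snd \<circ> snd \<circ> snd"
    by (rule coordinates_model)
  define f where "f = (\<lambda>g. word_class (G_gens n) (G_rels n) [(g, True)])"
  obtain h where hom: "h \<in> hom ?G ?M"
    and h: "\<And>w. w \<in> words (G_gens n) \<Longrightarrow> h (word_class (G_gens n) (G_rels n) w) = weval ?M model_gen w"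
    using M.presented_group_universal[OF model_gen_closed, where R = "G_rels n"] model_satisfies_relations
    unfolding G_group_def by blast
  have f_closed: "f \<in> G_gens n \<rightarrow> carrier ?G"
    by (auto simp: f_def G_group_def presented_group_gen_closed)
  have f_rels: "\<forall>(u, v) \<in> G_rels n. weval ?G f u = weval ?G f v"
    using G_rels_words[of n] presented_group_relation unfolding f_def G_group_def by blast
  have h_gen: "h (f g) = model_gen g" if "g \<in> G_gens n" for g
  proof -
    have "model_gen g \<in> carrier ?M" using that model_gen_closed by blast
    then show ?thesis using h[of "[(g, True)]"] that by (simp add: f_def words_def)
  qed
  interpret H: group_hom ?G ?M h by unfold_locales (rule hom)
  have gen_image: "model_gen g \<in> h ` carrier ?G" if "g \<in> G_gens n" for g
    using h_gen[OF that] f_closed that by (metis Pi_mem image_eqI)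
  have surj: "carrier ?M \<subseteq> h ` carrier ?G"
  proof (rule MC.carrier_subset_subgroup[OF H.img_is_subgroup])
    fix i assume "i \<in> {1..n}"
    then have "GenA i \<in> G_gens n" by (auto simp: G_gens_def)
    then show "\<exists>g\<in>h ` carrier ?G. fst g = {i} \<and> (fst \<circ> snd) g = {} \<and> (fst \<circ> snd \<circ> snd) g = {} \<and>
        (snd \<circ> snd \<circ> snd) g = {}"
      using gen_image[of "GenA i"] by (intro bexI[of _ "model_gen (GenA i)"]) (simp_all add: model_gen_def)
  next
    fix i assume "i \<in> {1..n}"
    then have "GenB i \<in> G_gens n" by (auto simp: G_gens_def)
    then show "\<exists>g\<in>h ` carrier ?G. fst g = {} \<and> (fst \<circ> snd) g = {i} \<and> (fst \<circ> snd \<circ> snd) g = {} \<and>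
        (snd \<circ> snd \<circ> snd) g = {}"
      using gen_image[of "GenB i"] by (intro bexI[of _ "model_gen (GenB i)"]) (simp_all add: model_gen_def)
  next
    fix j assume "j \<in> {1..n-1}"
    then have "GenC j \<in> G_gens n" by (auto simp: G_gens_def)
    then show "\<exists>g\<in>h ` carrier ?G. fst g = {} \<and> (fst \<circ> snd) g = {} \<and> (fst \<circ> snd \<circ> snd) g = {} \<and>
        (snd \<circ> snd \<circ> snd) g = {j}"
      using gen_image[of "GenC j"] by (intro bexI[of _ "model_gen (GenC j)"]) (simp_all add: model_gen_def)
  qed
  have gens: "f ` G_gens n = (\<lambda>i. f (GenA i)) ` {1..n} \<union> (\<lambda>i. f (GenB i)) ` {1..n} \<union>
      (\<lambda>j. f (GenC j)) ` {1..n-1}"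
    by (simp add: G_gens_def image_Un image_image)
  have generated: "carrier ?G = generate ?G (f ` G_gens n)"
    unfolding f_def G_group_def by (rule presented_group_generated)
  have bound: "finite (carrier ?G) \<and> card (carrier ?G) \<le> 2 ^ (4 * n - 1)"
  proof (rule G.relations_order_bound)
    show "carrier ?G = generate ?G ((\<lambda>i. f (GenA i)) ` {1..n} \<union> (\<lambda>i. f (GenB i)) ` {1..n} \<union>
      (\<lambda>j. f (GenC j)) ` {1..n-1})"
      using generated unfolding gens .
  qed (use f_rels[unfolded G.relations_iff[OF f_closed]] f_closed in \<open>auto simp: G_gens_def\<close>)
  have "inj_on h (carrier ?G)"
  proof (rule eq_card_imp_inj_on)
    have "card (carrier ?M) \<le> card (h ` carrier ?G)"
      using bound by (intro card_mono surj) auto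
    then show "card (h ` carrier ?G) = card (carrier ?G)"
      using bound card_image_le[of "carrier ?G" h] card_model[OF assms] by simp
  qed (use bound in auto)
  moreover have "h ` carrier ?G = carrier ?M"
    using surj hom by (auto simp: hom_def)
  ultimately have "h \<in> iso ?G ?M" using hom by (simp add: iso_iff)
  then have "coordinates ?G n (fst \<circ> h) (fst \<circ> snd \<circ> h) (fst \<circ> snd \<circ> snd \<circ> h) (snd \<circ> snd \<circ> snd \<circ> h)"
    by (intro coordinates.intro coordinates_axioms.intro G.is_group) simp
  then show ?thesis by blast
qed

theorem proposition5p5:
  fixes n :: nat
  assumes "n \<ge> 1"
  shows "indecomposable (G_group n)
    \<and> special_p_group 2 (G_group n) \<and> \<not> comm_group (G_group n)
    \<and> order (G_group n) = 2 ^ (4 * n - 1)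
    \<and> (\<exists>\<phi> \<in> auto (G_group n). group.ord (AutoGroup (G_group n)) \<phi> = 3
         \<and> Omega1 (G_group n) = center (G_group n)
         \<and> center (G_group n) = fixed_points (G_group n) \<phi>)"
proof -
  obtain X Y Z C where "coordinates (G_group n) n X Y Z C"
    using G_group_coordinates[OF assms] by blast
  then interpret coordinates "G_group n" n X Y Z C .
  show ?thesis
    using G_indecomposable special_2_group[OF assms] not_abelian[OF assms] order_eq[OF assms]
      Omega1_eq_center order_3_automorphism[OF assms] by blast
qed

end
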